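(* Let $K=\mathbb{R}$ or $K=\mathbb{C}$, $n\in\mathbb{Z}_{>0}$, let $E=C_u(\mathbb{R}^n,K)$ or $E=C_0(\mathbb{R}^n,K)$, and let the dual spaces $\tilde V_j,\tilde W_j\subset E^*$ be those associated with an $n$-dimensional tensor product mother scaling function $\varphi^{[n]}$. Then for every $j\in\mathbb{Z}$ $$\tilde V_{j+1}=\tilde V_j\dotplus\tilde W_j$$ as normed vector spaces.
   Context: $C_u(\mathbb{R}^n,K)$ (resp. $C_0(\mathbb{R}^n,K)$) is the Banach space of bounded uniformly continuous functions (resp. continuous functions vanishing at infinity) $\mathbb{R}^n\to K$, with the supremum norm; $E^*$ is the topological dual with the dual norm. $\varphi:\mathbb{R}\to K$ is continuous and compactly supported with $\varphi(k)=\delta_{k,0}$ for all $k\in\mathbb{Z}$ and $\varphi(x)=\sum_{k\in\mathbb{Z}}\varphi(k/2)\varphi(2x-k)$ for all $x\in\mathbb{R}$; $\varphi^{[n]}(x)=\prod_{i=1}^n\varphi(x_i)$. Put $\tilde g_{0,l}=\delta_{l,0}$ and $\tilde g_{1,l}=(-1)^{l-1}\varphi\bigl(\tfrac{1-l}{2}\bigr)$ for $l\in\mathbb{Z}$, and $\tilde g^{[n]}_{s,l}=\prod_{i=1}^n\tilde g_{s_i,l_i}$ for $s\in\{0,1\}^n$, $l\in\mathbb{Z}^n$. For $s\in\{0,1\}^n$, $j\in\mathbb{Z}$, $k\in\mathbb{Z}^n$ define $\tilde\psi^{[n]}_{s,j,k}\in E^*$ by $\langle\tilde\psi^{[n]}_{s,j,k},f\rangle=\sum_{l\in\mathbb{Z}^n}\tilde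 g^{[n]}_{s,l}\,f\bigl(\tfrac{2k+l}{2^{j+1}}\bigr)$ (a finite sum); in particular for $s=(0,\dots,0)$ this is $\tilde\varphi^{[n]}_{j,k}:f\mapsto f(k/2^j)$. Define $$\tilde V_j=\Bigl\{\sum_{k\in\mathbb{Z}^n}d_k\tilde\varphi^{[n]}_{j,k}: d\in\ell^1(\mathbb{Z}^n,K)\Bigr\},\qquad \tilde W_{s,j}=\Bigl\{\sum_{k\in\mathbb{Z}^n}d_k\tilde\psi^{[n]}_{s,j,k}: d\in\ell^1(\mathbb{Z}^n,K)\Bigr\},$$ with the norm of $E^*$, and let $\tilde W_j$ be the direct sum of the spaces $\tilde W_{s,j}$ over $s\in\{0,1\}^n\setminus\{(0,\dots,0)\}$. $A\dotplus B$ denotes the topological direct sum of subspaces of a Banach space: the algebraic direct sum with the inherited norm, in which both summands are topologically complemented. *)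

theory Defs
  imports "HOL-Analysis.Analysis"
begin

text \<open>
  The scalar field \<open>K\<close> is a type \<open>'k :: {real_normed_field, banach}\<close>. By the theorems of
  Ostrowski and Gelfand-Mazur, up to isometric isomorphism the types of this sort are exactly
  \<^typ>\<open>real\<close> and \<^typ>\<open>complex\<close>. The space \<open>R^n\<close> is \<open>real ^ 'n\<close>.
\<close>

section \<open>The function spaces\<close>

typedef (overloaded) ('a, 'k) cu =
  "{f :: 'a::euclidean_space \<Rightarrow>\<^sub>C 'k::real_normed_vector.
      uniformly_continuous_on UNIV (apply_bcontfun f)}"
  morphisms bcontfun_of_cu Abs_cu
  by (rule exI[of _ 0]) (simp add: uniformly_continuous_on_const zero_bcontfun.rep_eq)

typedef (overloaded) ('a, 'k) c0 =
  "{f :: 'a::euclidean_space \<Rightarrow>\<^sub>C 'k::real_normed_vector.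
      (apply_bcontfun f \<longlongrightarrow> 0) at_infinity}"
  morphisms bcontfun_of_c0 Abs_c0
  by (rule exI[of _ 0]) (simp add: zero_bcontfun.rep_eq)

setup_lifting type_definition_cu
setup_lifting type_definition_c0

text \<open>Both spaces carry the supremum norm inherited from \<^type>\<open>bcontfun\<close>.\<close>

instantiation cu :: (euclidean_space, real_normed_vector) real_normed_vector
begin

lift_definition zero_cu :: "('a, 'b) cu" is 0
  by (simp add: uniformly_continuous_on_const zero_bcontfun.rep_eq)

lift_definition plus_cu :: "('a, 'b) cu \<Rightarrow> ('a, 'b) cu \<Rightarrow> ('a, 'b) cu" is "(+)"
  by (simp add: plus_bcontfun.rep_eq uniformly_continuous_on_add)

lift_definition minus_cu :: "('a, 'b) cu \<Rightarrow> ('a, 'b) cu \<Rightarrow> ('a, 'b) cu" is "(-)"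
  by (simp add: minus_bcontfun.rep_eq uniformly_continuous_on_diff)

lift_definition uminus_cu :: "('a, 'b) cu \<Rightarrow> ('a, 'b) cu" is uminus
  by (simp add: uminus_bcontfun.rep_eq uniformly_continuous_on_minus)

lift_definition scaleR_cu :: "real \<Rightarrow> ('a, 'b) cu \<Rightarrow> ('a, 'b) cu" is scaleR
  by (simp add: scaleR_bcontfun.rep_eq uniformly_continuous_on_cmul)

lift_definition norm_cu :: "('a, 'b) cu \<Rightarrow> real" is norm .

lift_definition dist_cu :: "('a, 'b) cu \<Rightarrow> ('a, 'b) cu \<Rightarrow> real" is dist .

definition sgn_cu :: "('a, 'b) cu \<Rightarrow> ('a, 'b) cu"
  where "sgn_cu f = inverse (norm f) *\<^sub>R f"

definition uniformity_cu :: "(('a, 'b) cu \<times> ('a, 'b) cu) filter"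
  where "uniformity_cu = (INF e\<in>{0 <..}. principal {(x, y). dist x y < e})"

definition open_cu :: "('a, 'b) cu set \<Rightarrow> bool"
  where "open_cu S = (\<forall>x\<in>S. \<forall>\<^sub>F (x', y) in uniformity. x' = x \<longrightarrow> y \<in> S)"

instance
proof
  fix f g h :: "('a, 'b) cu" and a b :: real
  show "f + g + h = f + (g + h)" "f + g = g + f" "0 + f = f" "- f + f = 0" "f - g = f + - g"
    by (transfer, simp)+
  show "a *\<^sub>R (f + g) = a *\<^sub>R f + a *\<^sub>R g" "(a + b) *\<^sub>R f = a *\<^sub>R f + b *\<^sub>R f"
    "a *\<^sub>R b *\<^sub>R f = (a * b) *\<^sub>R f" "1 *\<^sub>R f = f"
    by (transfer, simp add: algebra_simps)+
  show "norm f = 0 \<longleftrightarrow> f = 0" "norm (f + g) \<le> norm f + norm g" "norm (a *\<^sub>R f) = \<bar>a\<bar> * norm f"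
    by (transfer, simp add: norm_triangle_ineq)+
  show "dist f g = norm (f - g)"
    by transfer (rule dist_norm)
qed (rule sgn_cu_def uniformity_cu_def open_cu_def)+

end

instantiation c0 :: (euclidean_space, real_normed_vector) real_normed_vector
begin

lift_definition zero_c0 :: "('a, 'b) c0" is 0
  by (simp add: zero_bcontfun.rep_eq)

lift_definition plus_c0 :: "('a, 'b) c0 \<Rightarrow> ('a, 'b) c0 \<Rightarrow> ('a, 'b) c0" is "(+)"
  by (simp add: plus_bcontfun.rep_eq tendsto_add_zero)

lift_definition minus_c0 :: "('a, 'b) c0 \<Rightarrow> ('a, 'b) c0 \<Rightarrow> ('a, 'b) c0" is "(-)"
  using tendsto_diff by (fastforce simp: minus_bcontfun.rep_eq)

lift_definition uminus_c0 :: "('a, 'b) c0 \<Rightarrow> ('a, 'b) c0" is uminus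
  using tendsto_minus by (fastforce simp: uminus_bcontfun.rep_eq)

lift_definition scaleR_c0 :: "real \<Rightarrow> ('a, 'b) c0 \<Rightarrow> ('a, 'b) c0" is scaleR
  using tendsto_scaleR[OF tendsto_const] by (fastforce simp: scaleR_bcontfun.rep_eq)

lift_definition norm_c0 :: "('a, 'b) c0 \<Rightarrow> real" is norm .

lift_definition dist_c0 :: "('a, 'b) c0 \<Rightarrow> ('a, 'b) c0 \<Rightarrow> real" is dist .

definition sgn_c0 :: "('a, 'b) c0 \<Rightarrow> ('a, 'b) c0"
  where "sgn_c0 f = inverse (norm f) *\<^sub>R f"

definition uniformity_c0 :: "(('a, 'b) c0 \<times> ('a, 'b) c0) filter"
  where "uniformity_c0 = (INF e\<in>{0 <..}. principal {(x, y). dist x y < e})"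

definition open_c0 :: "('a, 'b) c0 set \<Rightarrow> bool"
  where "open_c0 S = (\<forall>x\<in>S. \<forall>\<^sub>F (x', y) in uniformity. x' = x \<longrightarrow> y \<in> S)"

instance
proof
  fix f g h :: "('a, 'b) c0" and a b :: real
  show "f + g + h = f + (g + h)" "f + g = g + f" "0 + f = f" "- f + f = 0" "f - g = f + - g"
    by (transfer, simp)+
  show "a *\<^sub>R (f + g) = a *\<^sub>R f + a *\<^sub>R g" "(a + b) *\<^sub>R f = a *\<^sub>R f + b *\<^sub>R f"
    "a *\<^sub>R b *\<^sub>R f = (a * b) *\<^sub>R f" "1 *\<^sub>R f = f"
    by (transfer, simp add: algebra_simps)+
  show "norm f = 0 \<longleftrightarrow> f = 0" "norm (f + g) \<le> norm f + norm g" "norm (a *\<^sub>R f) = \<bar>a\<bar> * norm f"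
    by (transfer, simp add: norm_triangle_ineq)+
  show "dist f g = norm (f - g)"
    by transfer (rule dist_norm)
qed (rule sgn_c0_def uniformity_c0_def open_c0_def)+

end

definition cu_apply :: "('a::euclidean_space, 'k::real_normed_vector) cu \<Rightarrow> 'a \<Rightarrow> 'k"
  where "cu_apply f = apply_bcontfun (bcontfun_of_cu f)"

definition c0_apply :: "('a::euclidean_space, 'k::real_normed_vector) c0 \<Rightarrow> 'a \<Rightarrow> 'k"
  where "c0_apply f = apply_bcontfun (bcontfun_of_c0 f)"

section \<open>The dual space\<close>

text \<open>
  From here on \<open>E\<close> is a normed space \<open>'e\<close> of functions, and \<open>ev f x\<close> is the value of \<open>f\<close> at \<open>x\<close>;
  \<open>ev\<close> will be \<^const>\<open>cu_apply\<close> or \<^const>\<open>c0_apply\<close>. The library's \<open>'e \<Rightarrow>\<^sub>L 'k\<close> consists of the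
  bounded real-linear functionals; the dual over \<open>K\<close> is its subspace of \<open>K\<close>-homogeneous
  elements, with the operator norm.
\<close>

definition dual_space ::
    "('e \<Rightarrow> 'a \<Rightarrow> 'k) \<Rightarrow> ('e::real_normed_vector \<Rightarrow>\<^sub>L 'k::{real_normed_field,banach}) set"
  where "dual_space ev =
    {T. \<forall>c f g. (\<forall>x. ev g x = c * ev f x) \<longrightarrow> blinfun_apply T g = c * blinfun_apply T f}"

definition scaleK ::
    "'k \<Rightarrow> ('e::real_normed_vector \<Rightarrow>\<^sub>L 'k::{real_normed_field,banach}) \<Rightarrow> 'e \<Rightarrow>\<^sub>L 'k"
  where "scaleK c T = blinfun_mult_right c o\<^sub>L T"

definition subspaceK ::
    "('e::real_normed_vector \<Rightarrow>\<^sub>L 'k::{real_normed_field,banach}) set \<Rightarrow> bool"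
  where "subspaceK S \<longleftrightarrow> 0 \<in> S \<and> (\<forall>S1\<in>S. \<forall>S2\<in>S. S1 + S2 \<in> S) \<and> (\<forall>c. \<forall>T\<in>S. scaleK c T \<in> S)"

text \<open>
  \<open>C = A \<dotplus> B\<close> with the norm inherited from the ambient space. In view of the decomposition
  \<open>C = A + B\<close>, the maps \<open>P\<close> and \<open>Q\<close> are the projections of \<open>C\<close> onto \<open>A\<close> along \<open>B\<close> and onto \<open>B\<close>
  along \<open>A\<close>; they are automatically linear.
\<close>

definition topological_direct_sum ::
    "('e::real_normed_vector \<Rightarrow>\<^sub>L 'k::{real_normed_field,banach}) set \<Rightarrow> ('e \<Rightarrow>\<^sub>L 'k) set
      \<Rightarrow> ('e \<Rightarrow>\<^sub>L 'k) set \<Rightarrow> bool"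
  where "topological_direct_sum C A B \<longleftrightarrow>
    subspaceK A \<and> subspaceK B \<and>
    C = {a + b | a b. a \<in> A \<and> b \<in> B} \<and> A \<inter> B = {0} \<and>
    (\<exists>P. continuous_on C P \<and> (\<forall>a\<in>A. \<forall>b\<in>B. P (a + b) = a)) \<and>
    (\<exists>Q. continuous_on C Q \<and> (\<forall>a\<in>A. \<forall>b\<in>B. Q (a + b) = b))"

definition independent_family :: "'i set \<Rightarrow> ('i \<Rightarrow> 'v::ab_group_add set) \<Rightarrow> bool"
  where "independent_family I A \<longleftrightarrow>
    (\<forall>w. (\<forall>i\<in>I. w i \<in> A i) \<and> (\<Sum>i\<in>I. w i) = 0 \<longrightarrow> (\<forall>i\<in>I. w i = 0))"

section \<open>Mother scaling functions and the dual multiresolution spaces\<close>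

text \<open>The sum over \<open>k\<close> is finite because \<open>\<phi>\<close> has compact support.\<close>

definition mother_scaling_function :: "(real \<Rightarrow> 'k::{real_normed_field,banach}) \<Rightarrow> bool"
  where "mother_scaling_function \<phi> \<longleftrightarrow>
    continuous_on UNIV \<phi> \<and>
    compact (closure {x. \<phi> x \<noteq> 0}) \<and>
    (\<forall>k::int. \<phi> (of_int k) = (if k = 0 then 1 else 0)) \<and>
    (\<forall>x. \<phi> x = (\<Sum>k | \<phi> (of_int k / 2) \<noteq> 0. \<phi> (of_int k / 2) * \<phi> (2 * x - of_int k)))"

definition gtilde :: "(real \<Rightarrow> 'k::{real_normed_field,banach}) \<Rightarrow> int \<Rightarrow> int \<Rightarrow> 'k"
  where "gtilde \<phi> s l =
    (if s = 0 then (if l = 0 then 1 else 0) else (-1) powi (l - 1) * \<phi> (of_int (1 - l) / 2))"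

definition gtilde_tensor ::
    "(real \<Rightarrow> 'k::{real_normed_field,banach}) \<Rightarrow> int ^ 'n \<Rightarrow> int ^ 'n \<Rightarrow> 'k"
  where "gtilde_tensor \<phi> s l = (\<Prod>i\<in>UNIV. gtilde \<phi> (s $ i) (l $ i))"

definition dyadic :: "int \<Rightarrow> int ^ 'n \<Rightarrow> real ^ 'n"
  where "dyadic j k = (\<chi> i. of_int (k $ i) / 2 powi j)"

definition psi_tilde ::
    "('e \<Rightarrow> real ^ 'n \<Rightarrow> 'k) \<Rightarrow> (real \<Rightarrow> 'k) \<Rightarrow> int ^ 'n \<Rightarrow> int \<Rightarrow> int ^ 'n
      \<Rightarrow> ('e::real_normed_vector \<Rightarrow>\<^sub>L 'k::{real_normed_field,banach})"
  where "psi_tilde ev \<phi> s j k =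
    Blinfun (\<lambda>f. \<Sum>l | gtilde_tensor \<phi> s l \<noteq> 0.
      gtilde_tensor \<phi> s l * ev f (dyadic (j + 1) (\<chi> i. 2 * k $ i + l $ i)))"

definition phi_tilde ::
    "('e \<Rightarrow> real ^ 'n \<Rightarrow> 'k) \<Rightarrow> int \<Rightarrow> int ^ 'n
      \<Rightarrow> ('e::real_normed_vector \<Rightarrow>\<^sub>L 'k::{real_normed_field,banach})"
  where "phi_tilde ev j k = Blinfun (\<lambda>f. ev f (dyadic j k))"

text \<open>The series below converge in the norm of the dual space.\<close>

definition V_tilde ::
    "('e \<Rightarrow> real ^ 'n \<Rightarrow> 'k) \<Rightarrow> int
      \<Rightarrow> ('e::real_normed_vector \<Rightarrow>\<^sub>L 'k::{real_normed_field,banach}) set"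
  where "V_tilde ev j =
    {T \<in> dual_space ev. \<exists>d. (\<lambda>k. norm (d k)) summable_on UNIV \<and>
       ((\<lambda>k. scaleK (d k) (phi_tilde ev j k)) has_sum T) UNIV}"

definition W_tilde_component ::
    "('e \<Rightarrow> real ^ 'n \<Rightarrow> 'k) \<Rightarrow> (real \<Rightarrow> 'k) \<Rightarrow> int ^ 'n \<Rightarrow> int
      \<Rightarrow> ('e::real_normed_vector \<Rightarrow>\<^sub>L 'k::{real_normed_field,banach}) set"
  where "W_tilde_component ev \<phi> s j =
    {T \<in> dual_space ev. \<exists>d. (\<lambda>k. norm (d k)) summable_on UNIV \<and>
       ((\<lambda>k. scaleK (d k) (psi_tilde ev \<phi> s j k)) has_sum T) UNIV}"

definition wavelet_indices :: "(int ^ 'n) set"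
  where "wavelet_indices = {s. \<forall>i. s $ i \<in> {0, 1}} - {0}"

text \<open>
  The sum of the \<^const>\<open>W_tilde_component\<close>s; that it is direct is expressed by
  \<^const>\<open>independent_family\<close>.
\<close>

definition W_tilde ::
    "('e \<Rightarrow> real ^ 'n \<Rightarrow> 'k) \<Rightarrow> (real \<Rightarrow> 'k) \<Rightarrow> int
      \<Rightarrow> ('e::real_normed_vector \<Rightarrow>\<^sub>L 'k::{real_normed_field,banach}) set"
  where "W_tilde ev \<phi> j =
    {\<Sum>s\<in>wavelet_indices. w s | w. \<forall>s\<in>wavelet_indices. w s \<in> W_tilde_component ev \<phi> s j}"

section \<open>The functionals are elements of the dual\<close>

lemma bounded_linear_cu_apply: "bounded_linear (\<lambda>f. cu_apply f x)"
proof (rule bounded_linear_intro[where K = 1])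
  fix f g :: "('a, 'b) cu" and r :: real
  show "cu_apply (f + g) x = cu_apply f x + cu_apply g x"
    by (simp add: cu_apply_def plus_cu.rep_eq plus_bcontfun.rep_eq)
  show "cu_apply (r *\<^sub>R f) x = r *\<^sub>R cu_apply f x"
    by (simp add: cu_apply_def scaleR_cu.rep_eq scaleR_bcontfun.rep_eq)
  show "norm (cu_apply f x) \<le> norm f * 1"
    by (simp add: cu_apply_def norm_cu.rep_eq norm_bounded)
qed

lemma bounded_linear_c0_apply: "bounded_linear (\<lambda>f. c0_apply f x)"
proof (rule bounded_linear_intro[where K = 1])
  fix f g :: "('a, 'b) c0" and r :: real
  show "c0_apply (f + g) x = c0_apply f x + c0_apply g x"
    by (simp add: c0_apply_def plus_c0.rep_eq plus_bcontfun.rep_eq)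
  show "c0_apply (r *\<^sub>R f) x = r *\<^sub>R c0_apply f x"
    by (simp add: c0_apply_def scaleR_c0.rep_eq scaleR_bcontfun.rep_eq)
  show "norm (c0_apply f x) \<le> norm f * 1"
    by (simp add: c0_apply_def norm_c0.rep_eq norm_bounded)
qed

lemma psi_tilde_apply:
  assumes "\<And>x. bounded_linear (\<lambda>f. ev f x)"
  shows "blinfun_apply (psi_tilde ev \<phi> s j k) f =
    (\<Sum>l | gtilde_tensor \<phi> s l \<noteq> 0.
      gtilde_tensor \<phi> s l * ev f (dyadic (j + 1) (\<chi> i. 2 * k $ i + l $ i)))"
  unfolding psi_tilde_def
  by (subst bounded_linear_Blinfun_apply)
    (auto intro!: bounded_linear_sum bounded_linear_const_mult assms)

lemma phi_tilde_apply:
  assumes "\<And>x. bounded_linear (\<lambda>f. ev f x)"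
  shows "blinfun_apply (phi_tilde ev j k) f = ev f (dyadic j k)"
  unfolding phi_tilde_def by (simp add: bounded_linear_Blinfun_apply assms)

lemma psi_tilde_in_dual:
  assumes "\<And>x. bounded_linear (\<lambda>f. ev f x)"
  shows "psi_tilde ev \<phi> s j k \<in> dual_space ev"
  by (auto simp: dual_space_def psi_tilde_apply[OF assms] sum_distrib_left mult_ac intro!: sum.cong)

lemma psi_tilde_zero: "psi_tilde ev \<phi> 0 j k = phi_tilde ev j k"
proof -
  have g: "gtilde_tensor \<phi> 0 l = (if l = 0 then 1 else 0)" for l :: "int ^ 'n"
  proof (cases "l = 0")
    case False
    then obtain i where "l $ i \<noteq> 0" by (auto simp: vec_eq_iff)
    then show ?thesis
      using False by (auto simp: gtilde_tensor_def gtilde_def intro!: prod_zero)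
  qed (simp add: gtilde_tensor_def gtilde_def)
  have "dyadic (j + 1) (\<chi> i. 2 * k $ i) = dyadic j k"
    by (simp add: dyadic_def vec_eq_iff power_int_add)
  then show ?thesis
    by (simp add: psi_tilde_def phi_tilde_def g)
qed

end

theory Submission
  imports Defs
begin

text \<open>
  Finite linear combinations of evaluations at points of the lattice \<open>2^-(j+1) Z^n\<close> have as norm the sum
  of the absolute values of their coefficients, since a function of norm one with prescribed phases at
  finitely many lattice points can be built from cones with essentially disjoint supports, and such a
  function lies in \<open>C\<^sub>0\<close> and in \<open>C\<^sub>u\<close> (\<open>dyadic_interpolation\<close>). Hence the space \<open>V_tilde ev (j + 1)\<close> is an
  isometric copy of \<open>\<ell>\<^sup>1(Z^n)\<close> (\<open>ell1_norm_le\<close>, \<open>norm_le_ell1\<close>), and the statement becomes one about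
  sequences.

  The coefficients of a wavelet functional of type \<open>s\<close> form a translate, by an even vector, of the
  finitely supported filter \<open>gtilde_tensor \<phi> s\<close>, and \<open>s = 0\<close> gives the evaluations on the coarser lattice.
  In one dimension the two filters can be inverted explicitly: \<open>\<phi>\<close> is a Kronecker delta at the
  integers, so the wavelet filter has a single entry at odd positions, the wavelet coefficients are
  the entries of the sequence at odd positions, and what remains is supported on the coarser lattice.
  This yields dual filters of finite support (\<open>htilde\<close>) that are biorthogonal to the given ones
  (\<open>gtilde_htilde_biorthogonal\<close>) and resolve the identity (\<open>gtilde_htilde_resolution_sum\<close>). Both
  properties pass to tensor products (\<open>tensor_biorthogonal\<close>, \<open>tensor_resolution\<close>).

  Convolution with finitely supported filters is bounded on \<open>\<ell>\<^sup>1\<close>. The resolution of the identity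
  therefore shows that every element of \<open>V_tilde ev (j + 1)\<close> is a sum of components of all the types
  (\<open>V_tilde_finer_eq\<close>), and biorthogonality bounds the norm of each component by a multiple of the norm of
  the sum (\<open>component_norm_le\<close>). That inequality gives the uniqueness of the decomposition, so that all
  the sums are direct, and the continuity of the projections (\<open>topological_direct_sumI\<close>).
\<close>

section \<open>Matrices acting on summable families\<close>

abbreviation ell1 :: "('i \<Rightarrow> 'k::real_normed_vector) \<Rightarrow> bool"
  where "ell1 d \<equiv> (\<lambda>k. norm (d k)) summable_on UNIV"

definition kernel_apply ::
    "('i \<Rightarrow> 'j \<Rightarrow> 'k) \<Rightarrow> ('j \<Rightarrow> 'k) \<Rightarrow> 'i \<Rightarrow> 'k::{real_normed_field,banach}"
  where "kernel_apply a d i = (\<Sum>\<^sub>\<infinity>k. a i k * d k)"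

text \<open>
  A matrix whose columns are bounded in \<open>\<ell>\<^sup>1\<close> by \<open>B\<close> acts on \<open>\<ell>\<^sup>1\<close> with operator norm at most \<open>B\<close>. All of
  the statements below come from one application of Tonelli: the double family
  \<open>a i k * d k\<close> is absolutely summable because summing over \<open>i\<close> first gives at most
  \<open>B * norm (d k)\<close>.
\<close>

context
  fixes a :: "'i \<Rightarrow> 'j \<Rightarrow> 'k::{real_normed_field,banach}" and d :: "'j \<Rightarrow> 'k" and B :: real
  assumes column_summable: "\<And>k. (\<lambda>i. norm (a i k)) summable_on UNIV"
    and column_bound: "\<And>k. (\<Sum>\<^sub>\<infinity>i. norm (a i k)) \<le> B"
    and summable: "ell1 d"
begin

lemma kernel_summable: "(\<lambda>(k, i). norm (a i k * d k)) summable_on UNIV \<times> UNIV"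
proof (rule summable_on_SigmaI)
  show "((\<lambda>i. case (k, i) of (k, i) \<Rightarrow> norm (a i k * d k)) has_sum
      (\<Sum>\<^sub>\<infinity>i. norm (a i k)) * norm (d k)) UNIV" for k
    using has_sum_cmult_left[OF has_sum_infsum[OF column_summable[of k]], of "norm (d k)"]
    by (simp add: norm_mult)
  show "(\<lambda>k. (\<Sum>\<^sub>\<infinity>i. norm (a i k)) * norm (d k)) summable_on UNIV"
    by (rule summable_on_comparison_test[OF summable_on_cmult_right[OF summable, of B]])
      (auto intro!: mult_right_mono column_bound mult_nonneg_nonneg infsum_nonneg)
qed auto

lemma kernel_summable_swapped: "(\<lambda>(i, k). norm (a i k * d k)) summable_on UNIV \<times> UNIV"
  using kernel_summable summable_on_swap[of "\<lambda>(k, i). norm (a i k * d k)" UNIV UNIV]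
  by (simp add: case_prod_unfold)

lemma kernel_row_summable: "(\<lambda>k. norm (a i k * d k)) summable_on UNIV"
  using summable_on_SigmaD1[OF kernel_summable_swapped, of i] by simp

lemma kernel_row_sums_summable: "(\<lambda>i. \<Sum>\<^sub>\<infinity>k. norm (a i k * d k)) summable_on UNIV"
  using summable_on_Sigma_banach[OF kernel_summable_swapped] by simp

lemma norm_kernel_apply_le: "norm (kernel_apply a d i) \<le> (\<Sum>\<^sub>\<infinity>k. norm (a i k * d k))"
  unfolding kernel_apply_def using norm_infsum_bound[OF kernel_row_summable] .

lemma kernel_apply_summable: "ell1 (kernel_apply a d)"
  by (rule summable_on_comparison_test[OF kernel_row_sums_summable])
    (auto simp: norm_kernel_apply_le)

lemma kernel_apply_norm:
  "(\<Sum>\<^sub>\<infinity>i. norm (kernel_apply a d i)) \<le> B * (\<Sum>\<^sub>\<infinity>k. norm (d k))"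
proof -
  have "(\<Sum>\<^sub>\<infinity>i. norm (kernel_apply a d i)) \<le> (\<Sum>\<^sub>\<infinity>i. \<Sum>\<^sub>\<infinity>k. norm (a i k * d k))"
    by (intro infsum_mono kernel_apply_summable kernel_row_sums_summable norm_kernel_apply_le)
  also have "\<dots> = (\<Sum>\<^sub>\<infinity>k. \<Sum>\<^sub>\<infinity>i. norm (a i k * d k))"
    using infsum_swap_banach[OF kernel_summable_swapped] .
  also have "\<dots> \<le> (\<Sum>\<^sub>\<infinity>k. B * norm (d k))"
  proof (rule infsum_mono)
    show "(\<lambda>k. \<Sum>\<^sub>\<infinity>i. norm (a i k * d k)) summable_on UNIV"
      using summable_on_Sigma_banach[OF kernel_summable] by simp
    show "(\<Sum>\<^sub>\<infinity>i. norm (a i k * d k)) \<le> B * norm (d k)" for k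
      by (simp add: norm_mult infsum_cmult_left column_summable mult_right_mono column_bound)
  qed (intro summable_on_cmult_right summable)
  also have "\<dots> = B * (\<Sum>\<^sub>\<infinity>k. norm (d k))"
    by (rule infsum_cmult_right) (rule summable)
  finally show ?thesis .
qed

text \<open>
  Fubini in the form in which it is used throughout: a matrix can be moved from the coefficients of
  a series to the vectors. With \<open>v\<close> a bounded family of scalars this describes both the composition
  of two matrices and the change of the family of functionals in which a series is written.
\<close>

lemma infsum_kernel_apply:
  assumes "\<And>i. norm (v i) \<le> M"
  shows "(\<Sum>\<^sub>\<infinity>i. kernel_apply a d i * v i) = (\<Sum>\<^sub>\<infinity>k. d k * (\<Sum>\<^sub>\<infinity>i. a i k * v i))"
proof -
  have row: "(\<lambda>k. a i k * d k) summable_on UNIV" for i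
    by (rule abs_summable_summable[OF kernel_row_summable])
  have col: "(\<lambda>i. a i k * v i) summable_on UNIV" for k
  proof (rule abs_summable_summable)
    show "(\<lambda>i. norm (a i k * v i)) summable_on UNIV"
      by (rule summable_on_comparison_test[OF summable_on_cmult_left[OF column_summable, of k M]])
        (auto simp: norm_mult intro!: mult_left_mono assms)
  qed
  have "(\<lambda>(i, k). a i k * d k * v i) summable_on UNIV \<times> UNIV"
  proof (rule abs_summable_summable)
    show "(\<lambda>p. norm (case p of (i, k) \<Rightarrow> a i k * d k * v i)) summable_on UNIV \<times> UNIV"
      by (rule summable_on_comparison_test[OF summable_on_cmult_left[OF kernel_summable_swapped, of M]])
        (auto simp: norm_mult intro!: mult_left_mono assms)
  qed
  from infsum_swap_banach[OF this]
  have swap: "(\<Sum>\<^sub>\<infinity>i. \<Sum>\<^sub>\<infinity>k. a i k * d k * v i) = (\<Sum>\<^sub>\<infinity>k. \<Sum>\<^sub>\<infinity>i. a i k * d k * v i)" .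
  have "(\<Sum>\<^sub>\<infinity>k. a i k * d k * v i) = kernel_apply a d i * v i" for i
    unfolding kernel_apply_def by (rule infsum_cmult_left) (rule row)
  moreover have "(\<Sum>\<^sub>\<infinity>i. a i k * d k * v i) = d k * (\<Sum>\<^sub>\<infinity>i. a i k * v i)" for k
    using infsum_cmult_right[of "d k" "\<lambda>i. a i k * v i" UNIV, OF col] by (simp add: mult_ac)
  ultimately show ?thesis
    using swap by simp
qed

end

section \<open>Filters of stride two\<close>

text \<open>
  Upsampling by two followed by convolution with \<open>g\<close>. If \<open>g\<close> holds the coefficients of a wavelet
  functional in terms of point evaluations on the finer lattice, this turns wavelet coefficients into
  coefficients of point evaluations.
\<close>

definition synthesis :: "(int ^ 'n \<Rightarrow> 'k) \<Rightarrow> (int ^ 'n \<Rightarrow> 'k) \<Rightarrow> int ^ 'n \<Rightarrow> 'k::{real_normed_field,banach}"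
  where "synthesis g = kernel_apply (\<lambda>m k. g (m - 2 * k))"

text \<open>
  Correlation with \<open>h\<close> followed by downsampling by two, the transpose of \<^const>\<open>synthesis\<close>.
\<close>

definition analysis :: "(int ^ 'n \<Rightarrow> 'k) \<Rightarrow> (int ^ 'n \<Rightarrow> 'k) \<Rightarrow> int ^ 'n \<Rightarrow> 'k::{real_normed_field,banach}"
  where "analysis h = kernel_apply (\<lambda>k m. h (m - 2 * k))"

definition finite_support :: "('z \<Rightarrow> 'k::real_normed_field) \<Rightarrow> bool"
  where "finite_support g \<longleftrightarrow> finite {l. g l \<noteq> 0}"

text \<open>
  The \<open>\<ell>\<^sup>1\<close> norm of a filter; the sum runs over the support because only filters of finite support
  occur.
\<close>

definition filter_norm :: "('z \<Rightarrow> 'k::real_normed_field) \<Rightarrow> real"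
  where "filter_norm g = (\<Sum>l | g l \<noteq> 0. norm (g l))"

lemma filter_norm_nonneg: "0 \<le> filter_norm g"
  by (simp add: filter_norm_def sum_nonneg)

lemma finite_support_has_sum:
  assumes "finite_support g"
  shows "((\<lambda>l. norm (g l)) has_sum filter_norm g) UNIV"
  using assms unfolding finite_support_def filter_norm_def
  by (intro has_sum_finite_neutralI) auto

lemma finite_support_bounded:
  assumes "finite_support g"
  shows "norm (g l) \<le> filter_norm g"
  using finite_sum_le_has_sum[OF finite_support_has_sum[OF assms], of "{l}"] by simp

lemma synthesis_column:
  fixes g :: "int ^ 'n \<Rightarrow> 'k::real_normed_field"
  assumes "finite_support g"
  shows "((\<lambda>m. norm (g (m - 2 * k))) has_sum filter_norm g) UNIV"
proof -
  have "bij (\<lambda>m. m - 2 * k)"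
    by (rule bij_betw_byWitness[where f' = "\<lambda>m. m + 2 * k"]) auto
  from has_sum_reindex_bij_betw[OF this, of "\<lambda>l. norm (g l)"] show ?thesis
    using finite_support_has_sum[OF assms] by blast
qed

text \<open>
  A column only sees the values of \<open>h\<close> on one coset of the even lattice, so its norm may be strictly
  smaller than that of \<open>h\<close>.
\<close>

lemma analysis_column:
  fixes h :: "int ^ 'n \<Rightarrow> 'k::real_normed_field"
  assumes "finite_support h"
  shows "(\<lambda>k. norm (h (m - 2 * k))) summable_on UNIV"
    and "(\<Sum>\<^sub>\<infinity>k. norm (h (m - 2 * k))) \<le> filter_norm h"
proof -
  define r where "r k = m - 2 * k" for k :: "int ^ 'n"
  have inj: "inj r"
    by (auto simp: inj_def r_def vec_eq_iff)
  have h: "ell1 h" "(\<Sum>\<^sub>\<infinity>l. norm (h l)) = filter_norm h"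
    using finite_support_has_sum[OF assms] by (auto simp: has_sum_iff)
  have range: "(\<lambda>l. norm (h l)) summable_on range r"
    using summable_on_subset_banach[OF h(1)] by blast
  show "(\<lambda>k. norm (h (m - 2 * k))) summable_on UNIV"
    using range unfolding summable_on_reindex[OF inj] by (simp add: o_def r_def)
  have "(\<Sum>\<^sub>\<infinity>k. norm (h (r k))) = (\<Sum>\<^sub>\<infinity>l\<in>range r. norm (h l))"
    by (simp add: infsum_reindex[OF inj] o_def)
  also have "\<dots> \<le> (\<Sum>\<^sub>\<infinity>l. norm (h l))"
    by (intro infsum_mono_neutral range h(1)) auto
  finally show "(\<Sum>\<^sub>\<infinity>k. norm (h (m - 2 * k))) \<le> filter_norm h"
    by (simp add: h(2) r_def)
qed

lemma synthesis_summable: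
  assumes "finite_support g" "ell1 d"
  shows "ell1 (synthesis g d)"
  unfolding synthesis_def using synthesis_column[OF assms(1)] assms(2)
  by (intro kernel_apply_summable[where B = "filter_norm g"]) (auto simp: has_sum_iff)

lemma synthesis_norm:
  assumes "finite_support g" "ell1 d"
  shows "(\<Sum>\<^sub>\<infinity>m. norm (synthesis g d m)) \<le> filter_norm g * (\<Sum>\<^sub>\<infinity>k. norm (d k))"
  unfolding synthesis_def using synthesis_column[OF assms(1)] assms(2)
  by (intro kernel_apply_norm) (auto simp: has_sum_iff)

lemma infsum_synthesis:
  assumes "finite_support g" "ell1 d" "\<And>m. norm (v m) \<le> M"
  shows "(\<Sum>\<^sub>\<infinity>m. synthesis g d m * v m) = (\<Sum>\<^sub>\<infinity>k. d k * (\<Sum>\<^sub>\<infinity>m. g (m - 2 * k) * v m))"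
  unfolding synthesis_def using synthesis_column[OF assms(1)] assms(2,3)
  by (intro infsum_kernel_apply[where B = "filter_norm g"]) (auto simp: has_sum_iff)

lemma analysis_summable:
  assumes "finite_support h" "ell1 c"
  shows "ell1 (analysis h c)"
  unfolding analysis_def using analysis_column[OF assms(1)] assms(2)
  by (intro kernel_apply_summable[where B = "filter_norm h"]) auto

lemma analysis_norm:
  assumes "finite_support h" "ell1 c"
  shows "(\<Sum>\<^sub>\<infinity>k. norm (analysis h c k)) \<le> filter_norm h * (\<Sum>\<^sub>\<infinity>m. norm (c m))"
  unfolding analysis_def using analysis_column[OF assms(1)] assms(2)
  by (intro kernel_apply_norm) auto

lemma infsum_analysis:
  assumes "finite_support h" "ell1 c" "\<And>k. norm (v k) \<le> M"
  shows "(\<Sum>\<^sub>\<infinity>k. analysis h c k * v k) = (\<Sum>\<^sub>\<infinity>m. c m * (\<Sum>\<^sub>\<infinity>k. h (m - 2 * k) * v k))"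
  unfolding analysis_def using analysis_column[OF assms(1)] assms(2,3)
  by (intro infsum_kernel_apply[where B = "filter_norm h"]) auto

lemma infsum_delta: "(\<Sum>\<^sub>\<infinity>m. c m * (if m = k then e else 0)) = c k * (e :: 'k::real_normed_field)"
proof -
  have "(\<Sum>\<^sub>\<infinity>m. c m * (if m = k then e else 0)) = (\<Sum>\<^sub>\<infinity>m\<in>{k}. c m * e)"
    by (rule infsum_cong_neutral) auto
  then show ?thesis by simp
qed

text \<open>
  The product of the two matrices is computed entrywise, by \<open>infsum_synthesis\<close> with a column of the
  analysis matrix as the bounded family.
\<close>

lemma analysis_synthesis:
  assumes "finite_support g" "finite_support h" "ell1 d"
    and "\<And>k k'. (\<Sum>\<^sub>\<infinity>m. g (m - 2 * k) * h (m - 2 * k')) = (if k = k' then e else 0)"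
  shows "analysis h (synthesis g d) k = e * d k"
proof -
  have "analysis h (synthesis g d) k = (\<Sum>\<^sub>\<infinity>m. synthesis g d m * h (m - 2 * k))"
    by (simp add: analysis_def kernel_apply_def mult.commute)
  also have "\<dots> = (\<Sum>\<^sub>\<infinity>k'. d k' * (if k' = k then e else 0))"
    using assms(4) by (subst infsum_synthesis[OF assms(1,3) finite_support_bounded[OF assms(2)]]) simp
  finally show ?thesis by (simp add: infsum_delta)
qed

lemma analysis_add:
  assumes "finite_support h" "ell1 c" "ell1 c'"
  shows "analysis h (\<lambda>m. c m + c' m) k = analysis h c k + analysis h c' k"
proof -
  have "(\<lambda>m. h (m - 2 * k) * x m) summable_on UNIV" if "ell1 x" for x
    using kernel_row_summable[OF analysis_column[OF assms(1)] that]
    by (rule abs_summable_summable)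
  then show ?thesis
    using assms by (simp add: analysis_def kernel_apply_def distrib_left infsum_add)
qed

text \<open>
  Summability of the sum is part of the statement because the induction needs it.
\<close>

lemma analysis_sum:
  assumes "finite_support h" "finite S" "\<And>s. s \<in> S \<Longrightarrow> ell1 (c s)"
  shows "ell1 (\<lambda>m. \<Sum>s\<in>S. c s m) \<and>
    analysis h (\<lambda>m. \<Sum>s\<in>S. c s m) k = (\<Sum>s\<in>S. analysis h (c s) k)"
  using assms(2,3)
proof (induction S rule: finite_induct)
  case empty
  then show ?case by (simp add: analysis_def kernel_apply_def)
next
  case (insert s S)
  then have s: "ell1 (c s)"
    and S: "ell1 (\<lambda>m. \<Sum>s\<in>S. c s m)" by auto
  have "ell1 (\<lambda>m. c s m + (\<Sum>s\<in>S. c s m))"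
    by (rule summable_on_comparison_test[OF summable_on_add[OF s S]]) (auto intro: norm_triangle_ineq)
  then show ?case
    using insert analysis_add[OF assms(1) s S] by simp
qed

text \<open>
  The hypothesis \<open>recon\<close> says that the sum over \<open>s\<close> of the matrices of synthesis after analysis is the
  identity matrix. For each \<open>s\<close> the entries in a fixed row are bounded, so the action of that matrix on
  \<open>c\<close> is an absolutely convergent series, and the finite sum over \<open>s\<close> may be taken inside.
\<close>

lemma synthesis_analysis:
  fixes g h :: "'s \<Rightarrow> int ^ 'n \<Rightarrow> 'k::{real_normed_field,banach}"
  assumes "finite S" "\<And>s. s \<in> S \<Longrightarrow> finite_support (g s)" "\<And>s. s \<in> S \<Longrightarrow> finite_support (h s)"
    and c: "ell1 c"
    and recon: "\<And>m m'. (\<Sum>s\<in>S. \<Sum>\<^sub>\<infinity>k. h s (m - 2 * k) * g s (m' - 2 * k)) = (if m = m' then 1 else 0)"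
  shows "(\<Sum>s\<in>S. synthesis (g s) (analysis (h s) c) m) = c m"
proof -
  let ?x = "\<lambda>s m'. \<Sum>\<^sub>\<infinity>k. h s (m' - 2 * k) * g s (m - 2 * k)"
  have "((\<lambda>m'. \<Sum>s\<in>T. c m' * ?x s m') has_sum (\<Sum>s\<in>T. synthesis (g s) (analysis (h s) c) m)) UNIV"
    if "T \<subseteq> S" for T
    using finite_subset[OF that assms(1)] that
  proof (induction T rule: finite_induct)
    case (insert s T)
    then have s: "finite_support (g s)" "finite_support (h s)" using assms(2,3) by auto
    have bound: "norm (?x s m') \<le> filter_norm (h s) * filter_norm (g s)" for m'
    proof -
      let ?f = "\<lambda>k. norm (h s (m' - 2 * k)) * filter_norm (g s)"
      have f: "?f summable_on UNIV"
        by (intro summable_on_cmult_left analysis_column s)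
      have le: "norm (h s (m' - 2 * k) * g s (m - 2 * k)) \<le> ?f k" for k
        unfolding norm_mult by (intro mult_left_mono finite_support_bounded s norm_ge_zero)
      have sm: "(\<lambda>k. norm (h s (m' - 2 * k) * g s (m - 2 * k))) summable_on UNIV"
        by (rule summable_on_comparison_test[OF f]) (auto simp: le)
      have "norm (?x s m') \<le> (\<Sum>\<^sub>\<infinity>k. norm (h s (m' - 2 * k) * g s (m - 2 * k)))"
        by (rule norm_infsum_bound) (rule sm)
      also have "\<dots> \<le> infsum ?f UNIV"
        by (intro infsum_mono sm f le)
      also have "\<dots> = (\<Sum>\<^sub>\<infinity>k. norm (h s (m' - 2 * k))) * filter_norm (g s)"
        by (intro infsum_cmult_left analysis_column s)
      also have "\<dots> \<le> filter_norm (h s) * filter_norm (g s)"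
        by (intro mult_right_mono analysis_column s filter_norm_nonneg)
      finally show ?thesis .
    qed
    have "(\<lambda>m'. c m' * ?x s m') summable_on UNIV"
    proof (rule abs_summable_summable)
      show "(\<lambda>m'. norm (c m' * ?x s m')) summable_on UNIV"
        by (rule summable_on_comparison_test
            [OF summable_on_cmult_left[OF c, of "filter_norm (h s) * filter_norm (g s)"]])
          (auto simp: norm_mult intro!: mult_left_mono bound)
    qed
    moreover have "(\<Sum>\<^sub>\<infinity>m'. c m' * ?x s m') = synthesis (g s) (analysis (h s) c) m"
      using infsum_analysis[OF s(2) c, of "\<lambda>k. g s (m - 2 * k)" "filter_norm (g s)"]
      by (simp add: synthesis_def kernel_apply_def mult.commute finite_support_bounded s)
    ultimately have "((\<lambda>m'. c m' * ?x s m') has_sum synthesis (g s) (analysis (h s) c) m) UNIV"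
      by (simp add: has_sum_iff)
    from has_sum_add[OF this insert.IH] show ?case
      using insert by simp
  qed simp
  from infsumI[OF this[OF subset_refl]] show ?thesis
    using recon by (simp add: infsum_delta flip: sum_distrib_left)
qed

section \<open>Biorthogonality of the interpolating wavelet filters\<close>

text \<open>
  The filters dual to \<^const>\<open>gtilde\<close>. In one dimension, write a finitely supported combination of point
  evaluations as \<open>\<Sum>m. c m * \<delta> (m / 2)\<close>. Since \<open>gtilde \<phi> 1\<close> is \<open>1\<close> at \<open>1\<close> and vanishes at all other odd
  integers, the coefficient of the \<open>k\<close>-th wavelet can only be \<open>c (2 * k + 1)\<close>; subtracting the wavelets
  leaves a sequence supported on the even integers, with entries \<open>\<Sum>l. \<phi> (l / 2) * c (2 * k + l)\<close>.
\<close>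

definition htilde :: "(real \<Rightarrow> 'k::{real_normed_field,banach}) \<Rightarrow> int \<Rightarrow> int \<Rightarrow> 'k"
  where "htilde \<phi> s l =
    (if s = 0 then \<phi> (of_int l / 2) else (if l = 1 then 1 else 0))"

definition htilde_tensor ::
    "(real \<Rightarrow> 'k::{real_normed_field,banach}) \<Rightarrow> int ^ 'n \<Rightarrow> int ^ 'n \<Rightarrow> 'k"
  where "htilde_tensor \<phi> s l = (\<Prod>i\<in>UNIV. htilde \<phi> (s $ i) (l $ i))"

context
  fixes \<phi> :: "real \<Rightarrow> 'k::{real_normed_field,banach}"
  assumes cardinal: "\<And>k::int. \<phi> (of_int k) = (if k = 0 then 1 else 0)"
begin

lemma gtilde_odd: "gtilde \<phi> 1 (2 * p + 1) = (if p = 0 then 1 else 0)"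
proof -
  have "real_of_int (1 - (2 * p + 1)) / 2 = of_int (- p)" by simp
  then show ?thesis
    using cardinal[of "- p"] by (simp add: gtilde_def power_int_mult)
qed

lemma gtilde_even: "gtilde \<phi> 1 (2 * p) = - \<phi> (1 / 2 - of_int p)"
proof -
  have "(-1 :: 'k) powi (2 * p - 1) = -1"
    by (simp add: power_int_minus_left_odd)
  moreover have "real_of_int (1 - 2 * p) / 2 = 1 / 2 - of_int p" by (simp add: field_simps)
  ultimately show ?thesis by (simp only: gtilde_def) simp
qed

lemma htilde_even: "htilde \<phi> 0 (2 * p) = (if p = 0 then 1 else 0)"
  using cardinal[of p] by (simp add: htilde_def)

text \<open>
  Apart from the pair \<open>s = 1\<close>, \<open>s' = 0\<close>, one of the two factors is a Kronecker delta in \<open>m\<close>, and at the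
  only relevant \<open>m\<close> the other factor is a Kronecker delta in \<open>k\<close> and \<open>k'\<close> or vanishes. For the
  remaining pair at most one even and one odd \<open>m\<close> contribute, and the sign in \<open>gtilde \<phi> 1\<close> makes the two
  contributions cancel.
\<close>

lemma gtilde_htilde_biorthogonal:
  assumes "s \<in> {0, 1}" "s' \<in> {0, 1}"
  shows "((\<lambda>m. gtilde \<phi> s (m - 2 * k) * htilde \<phi> s' (m - 2 * k'))
    has_sum (if s = s' \<and> k = k' then 1 else 0)) UNIV"
proof -
  consider "s = 0" "s' = 0" | "s = 1" "s' = 1" | "s = 0" "s' = 1" | "s = 1" "s' = 0"
    using assms by auto
  then show ?thesis
  proof cases
    case 1
    then show ?thesis
      using htilde_even[of "k - k'"]
      by (intro has_sum_finite_neutralI[of "{2 * k}"]) (auto simp: gtilde_def right_diff_distrib)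
  next
    case 2
    have shift: "2 * k' + 1 - 2 * k = 2 * (k' - k) + 1" by simp
    have "gtilde \<phi> 1 (2 * k' + 1 - 2 * k) = (if k = k' then 1 else 0)"
      unfolding shift gtilde_odd by auto
    then show ?thesis
      using 2
      by (intro has_sum_finite_neutralI[of "{2 * k' + 1}"]) (auto simp: htilde_def)
  next
    case 3
    have "2 * k - 2 * k' \<noteq> 1" by presburger
    then show ?thesis
      using 3 by (intro has_sum_finite_neutralI[of "{}"]) (auto simp: htilde_def gtilde_def)
  next
    case 4
    have ne: "2 * k' \<noteq> 2 * k + 1" by presburger
    have odd: "htilde \<phi> 0 (2 * k + 1 - 2 * k') = \<phi> (1 / 2 + of_int k - of_int k')"
    proof -
      have "real_of_int (2 * k + 1 - 2 * k') / 2 = 1 / 2 + of_int k - of_int k'"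
        by (simp add: field_simps)
      then show ?thesis by (simp only: htilde_def) simp
    qed
    have even: "gtilde \<phi> 1 (2 * k' - 2 * k) = - \<phi> (1 / 2 + of_int k - of_int k')"
    proof -
      have "2 * k' - 2 * k = 2 * (k' - k)"
        "1 / 2 - real_of_int (k' - k) = 1 / 2 + of_int k - of_int k'" by simp_all
      then show ?thesis by (metis gtilde_even)
    qed
    \<comment> \<open>At the other even \<open>m\<close> the second factor vanishes, at the other odd \<open>m\<close> the first one.\<close>
    have zero: "gtilde \<phi> 1 (m - 2 * k) * htilde \<phi> 0 (m - 2 * k') = 0"
      if "m \<noteq> 2 * k'" "m \<noteq> 2 * k + 1" for m
    proof (cases "even m")
      case True
      then obtain p where "m = 2 * p" by blast
      then show ?thesis
        using htilde_even[of "p - k'"] that by (simp add: right_diff_distrib)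
    next
      case False
      then obtain p where m: "m = 2 * p + 1" by (rule oddE)
      have shift: "2 * p + 1 - 2 * k = 2 * (p - k) + 1" by simp
      have "gtilde \<phi> 1 (2 * p + 1 - 2 * k) = 0"
        unfolding shift gtilde_odd using m that by auto
      then show ?thesis by (simp add: m)
    qed
    have one: "gtilde \<phi> 1 1 = 1" "htilde \<phi> 0 0 = 1"
      using gtilde_odd[of 0] htilde_even[of 0] by simp_all
    show ?thesis
      using 4 ne
      by (intro has_sum_finite_neutralI[of "{2 * k', 2 * k + 1}"])
        (auto simp: zero odd even one)
  qed
qed

text \<open>
  In each of the two sums at most one \<open>k\<close> contributes: the support of \<open>gtilde \<phi> 0\<close> forces \<open>m' = 2 * k\<close>, that
  of \<open>htilde \<phi> 1\<close> forces \<open>m = 2 * k + 1\<close>.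
\<close>

lemma gtilde_htilde_resolution:
  shows "((\<lambda>k. htilde \<phi> 0 (m - 2 * k) * gtilde \<phi> 0 (m' - 2 * k)) has_sum
      (if even m' then \<phi> (of_int (m - m') / 2) else 0)) UNIV"
    and "((\<lambda>k. htilde \<phi> 1 (m - 2 * k) * gtilde \<phi> 1 (m' - 2 * k)) has_sum
      (if odd m then (if even m' then - \<phi> (of_int (m - m') / 2) else if m = m' then 1 else 0)
       else 0)) UNIV"
proof -
  show "((\<lambda>k. htilde \<phi> 0 (m - 2 * k) * gtilde \<phi> 0 (m' - 2 * k)) has_sum
      (if even m' then \<phi> (of_int (m - m') / 2) else 0)) UNIV"
    by (rule has_sum_finite_neutralI[of "if even m' then {m' div 2} else {}"])
      (auto simp: htilde_def gtilde_def)
  show "((\<lambda>k. htilde \<phi> 1 (m - 2 * k) * gtilde \<phi> 1 (m' - 2 * k)) has_sum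
      (if odd m then (if even m' then - \<phi> (of_int (m - m') / 2) else if m = m' then 1 else 0)
       else 0)) UNIV"
  proof (cases "odd m")
    case True
    then obtain p where m: "m = 2 * p + 1" by (rule oddE)
    have "gtilde \<phi> 1 (m' - 2 * p) =
        (if even m' then - \<phi> (of_int (m - m') / 2) else if m = m' then 1 else 0)"
    proof (cases "even m'")
      case True
      then obtain q where "m' = 2 * q" by blast
      then have "m' - 2 * p = 2 * (q - p)" "1 / 2 - real_of_int (q - p) = of_int (m - m') / 2"
        using m by (simp_all add: field_simps)
      then show ?thesis
        using True by (simp only: gtilde_even if_True)
    next
      case False
      then obtain q where q: "m' = 2 * q + 1" by (rule oddE)
      then have shift: "m' - 2 * p = 2 * (q - p) + 1" by simp
      show ?thesis
        unfolding shift gtilde_odd using m q by auto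
    qed
    then show ?thesis
      using m by (intro has_sum_finite_neutralI[of "{p}"]) (auto simp: htilde_def)
  next
    case False
    then have "m - 2 * k \<noteq> 1" for k by presburger
    with False show ?thesis
      by (intro has_sum_finite_neutralI[of "{}"]) (auto simp: htilde_def)
  qed
qed

text \<open>
  For odd \<open>m\<close> and even \<open>m'\<close> the values of \<open>\<phi>\<close> at half an odd integer cancel; for even \<open>m\<close> and \<open>m'\<close> the
  value of \<open>\<phi>\<close> is taken at an integer and is the required delta.
\<close>

lemma gtilde_htilde_resolution_sum:
  "(\<Sum>s\<in>{0, 1}. \<Sum>\<^sub>\<infinity>k. htilde \<phi> s (m - 2 * k) * gtilde \<phi> s (m' - 2 * k)) =
    (if m = m' then 1 else 0)"
proof -
  have "\<phi> (of_int (m - m') / 2) = (if m = m' then 1 else 0)" if "even m" "even m'"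
  proof -
    have "even (m - m')" using that by simp
    then obtain p where "m - m' = 2 * p" by blast
    then show ?thesis using cardinal[of p] by simp
  qed
  then show ?thesis
    using infsumI[OF gtilde_htilde_resolution(1)[of m m']]
      infsumI[OF gtilde_htilde_resolution(2)[of m m']] by auto
qed

end

section \<open>Tensor products\<close>

lemma sum_vec_box:
  fixes F :: "'n::finite \<Rightarrow> 'a \<Rightarrow> 'k::comm_semiring_1"
  assumes "\<And>i. finite (B i)"
  shows "(\<Sum>m | \<forall>i. m $ i \<in> B i. \<Prod>i\<in>UNIV. F i (m $ i)) = (\<Prod>i\<in>UNIV. \<Sum>l\<in>B i. F i l)"
proof -
  have "(\<Prod>i\<in>UNIV. \<Sum>l\<in>B i. F i l) = (\<Sum>g\<in>PiE UNIV B. \<Prod>i\<in>UNIV. F i (g i))"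
    by (rule prod_sum_PiE) (auto simp: assms)
  also have "\<dots> = (\<Sum>m | \<forall>i. m $ i \<in> B i. \<Prod>i\<in>UNIV. F i (m $ i))"
    by (rule sum.reindex_bij_witness[of _ "\<lambda>m. ($) m" vec_lambda]) (auto simp: PiE_def)
  finally show ?thesis ..
qed

lemma finite_vec_box:
  fixes B :: "'n::finite \<Rightarrow> 'a set"
  assumes "\<And>i. finite (B i)"
  shows "finite {m :: 'a ^ 'n. \<forall>i. m $ i \<in> B i}"
proof -
  have "{m :: 'a ^ 'n. \<forall>i. m $ i \<in> B i} \<subseteq> vec_lambda ` PiE UNIV B"
  proof
    fix m :: "'a ^ 'n" assume "m \<in> {m. \<forall>i. m $ i \<in> B i}"
    then show "m \<in> vec_lambda ` PiE UNIV B"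
      by (intro image_eqI[where x = "\<lambda>i. m $ i"]) (simp_all add: PiE_UNIV_domain)
  qed
  then show ?thesis
    by (rule finite_subset) (intro finite_imageI finite_PiE finite assms)
qed

lemma has_sum_tensor:
  fixes F :: "'n::finite \<Rightarrow> 'a \<Rightarrow> 'k::real_normed_field"
  assumes fin: "\<And>i. finite {l. F i l \<noteq> 0}" and sum: "\<And>i. (F i has_sum a i) UNIV"
  shows "((\<lambda>m. \<Prod>i\<in>UNIV. F i (m $ i)) has_sum (\<Prod>i\<in>UNIV. a i)) UNIV"
proof (rule has_sum_finite_neutralI)
  let ?B = "\<lambda>i. {l. F i l \<noteq> 0}"
  show "finite {m :: 'a ^ 'n. \<forall>i. m $ i \<in> ?B i}"
    by (rule finite_vec_box) (rule fin)
  show "(\<Prod>i\<in>UNIV. F i (m $ i)) = 0" if "m \<in> UNIV - {m. \<forall>i. m $ i \<in> ?B i}" for m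
    using that by simp
  have "a i = (\<Sum>l\<in>?B i. F i l)" for i
  proof (rule has_sum_unique[OF sum])
    show "(F i has_sum (\<Sum>l\<in>?B i. F i l)) UNIV"
      by (rule has_sum_finite_neutralI[OF fin[of i]]) simp_all
  qed
  then show "(\<Prod>i\<in>UNIV. a i) = (\<Sum>m | \<forall>i. m $ i \<in> ?B i. \<Prod>i\<in>UNIV. F i (m $ i))"
    using sum_vec_box[of ?B F, OF fin] by simp
qed auto

lemma finite_support_tensor:
  fixes F :: "'n::finite \<Rightarrow> 'a \<Rightarrow> 'k::real_normed_field"
  assumes "\<And>i. finite {l. F i l \<noteq> 0}"
  shows "finite_support (\<lambda>m. \<Prod>i\<in>UNIV. F i (m $ i))"
  unfolding finite_support_def
  by (rule finite_subset[OF _ finite_vec_box[of "\<lambda>i. {l. F i l \<noteq> 0}", OF assms]]) auto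

lemma finite_half_integer_samples:
  fixes \<phi> :: "real \<Rightarrow> 'k::zero"
  assumes "compact (closure {x. \<phi> x \<noteq> 0})"
  shows "finite {l::int. \<phi> (of_int l / 2) \<noteq> 0}"
proof -
  have "bounded {x. \<phi> x \<noteq> 0}"
    using compact_imp_bounded[OF assms] bounded_subset closure_subset by blast
  then obtain b where b: "\<And>x. \<phi> x \<noteq> 0 \<Longrightarrow> \<bar>x\<bar> \<le> b"
    by (auto simp: bounded_iff)
  have "{l::int. \<phi> (of_int l / 2) \<noteq> 0} \<subseteq> {\<lfloor>- 2 * b\<rfloor>..\<lceil>2 * b\<rceil>}"
  proof
    fix l :: int assume "l \<in> {l. \<phi> (of_int l / 2) \<noteq> 0}"
    then have "- 2 * b \<le> of_int l" "of_int l \<le> 2 * b" using b[of "of_int l / 2"] by auto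
    then show "l \<in> {\<lfloor>- 2 * b\<rfloor>..\<lceil>2 * b\<rceil>}" by (auto simp: floor_le_iff le_ceiling_iff)
  qed
  then show ?thesis by (rule finite_subset) simp
qed

context
  fixes \<phi> :: "real \<Rightarrow> 'k::{real_normed_field,banach}"
  assumes msf: "mother_scaling_function \<phi>"
begin

lemma mother_scaling_function_cardinal: "\<phi> (of_int k) = (if k = 0 then 1 else 0)"
  using msf unfolding mother_scaling_function_def by blast

lemma finite_half_integers: "finite {l::int. \<phi> (of_int l / 2) \<noteq> 0}"
  using msf unfolding mother_scaling_function_def by (intro finite_half_integer_samples) blast

lemma finite_htilde: "finite {l. htilde \<phi> s l \<noteq> 0}"
proof (cases "s = 0")
  case True
  then show ?thesis
    using finite_half_integers by (simp add: htilde_def)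
next
  case False
  then have "{l. htilde \<phi> s l \<noteq> 0} \<subseteq> {1}" by (auto simp: htilde_def)
  then show ?thesis by (rule finite_subset) simp
qed

lemma finite_gtilde: "finite {l. gtilde \<phi> s l \<noteq> 0}"
proof (cases "s = 0")
  case True
  then have "{l. gtilde \<phi> s l \<noteq> 0} \<subseteq> {0}" by (auto simp: gtilde_def)
  then show ?thesis by (rule finite_subset) simp
next
  case False
  have "finite ((\<lambda>l. 1 - l) ` {l::int. \<phi> (of_int l / 2) \<noteq> 0})"
    by (intro finite_imageI finite_half_integers)
  moreover have "{l. gtilde \<phi> s l \<noteq> 0} \<subseteq> (\<lambda>l. 1 - l) ` {l::int. \<phi> (of_int l / 2) \<noteq> 0}"
  proof
    fix l assume "l \<in> {l. gtilde \<phi> s l \<noteq> 0}"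
    then show "l \<in> (\<lambda>l. 1 - l) ` {l::int. \<phi> (of_int l / 2) \<noteq> 0}"
      using False by (intro image_eqI[of _ _ "1 - l"]) (auto simp: gtilde_def)
  qed
  ultimately show ?thesis by (rule finite_subset[rotated])
qed

lemma finite_support_gtilde_tensor: "finite_support (gtilde_tensor \<phi> s)"
  using finite_support_tensor[of "\<lambda>i. gtilde \<phi> (s $ i)"] finite_gtilde
  by (simp add: gtilde_tensor_def[abs_def])

lemma finite_support_htilde_tensor: "finite_support (htilde_tensor \<phi> s)"
  using finite_support_tensor[of "\<lambda>i. htilde \<phi> (s $ i)"] finite_htilde
  by (simp add: htilde_tensor_def[abs_def])

lemma prod_if_delta:
  "(\<Prod>i\<in>(UNIV :: 'n::finite set). if P i then 1 else 0 :: 'k) = (if \<forall>i. P i then 1 else 0)"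
  by simp

text \<open>
  The sum over \<open>int ^ 'n\<close> of a product of functions of one coordinate each is the product of the
  one-dimensional sums, and a product of Kronecker deltas over the coordinates is the Kronecker delta of
  the vectors. The same holds for the resolution of the identity below, where the sum over \<open>s\<close> is
  distributed over the coordinates as well.
\<close>

lemma tensor_biorthogonal:
  fixes s s' k k' :: "int ^ 'n"
  assumes "\<forall>i. s $ i \<in> {0, 1}" "\<forall>i. s' $ i \<in> {0, 1}"
  shows "(\<Sum>\<^sub>\<infinity>m. gtilde_tensor \<phi> s (m - 2 * k) * htilde_tensor \<phi> s' (m - 2 * k')) =
    (if k = k' then if s = s' then 1 else 0 else 0)"
proof -
  let ?F = "\<lambda>i m. gtilde \<phi> (s $ i) (m - 2 * k $ i) * htilde \<phi> (s' $ i) (m - 2 * k' $ i)"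
  have "finite {m. ?F i m \<noteq> 0}" for i
  proof -
    have "finite ((\<lambda>l. l + 2 * k $ i) ` {l. gtilde \<phi> (s $ i) l \<noteq> 0})"
      by (intro finite_imageI finite_gtilde)
    moreover have "{m. ?F i m \<noteq> 0} \<subseteq> (\<lambda>l. l + 2 * k $ i) ` {l. gtilde \<phi> (s $ i) l \<noteq> 0}"
    proof
      fix m assume "m \<in> {m. ?F i m \<noteq> 0}"
      then show "m \<in> (\<lambda>l. l + 2 * k $ i) ` {l. gtilde \<phi> (s $ i) l \<noteq> 0}"
        by (intro image_eqI[of _ _ "m - 2 * k $ i"]) auto
    qed
    ultimately show ?thesis by (rule finite_subset[rotated])
  qed
  then have "((\<lambda>m. \<Prod>i\<in>UNIV. ?F i (m $ i)) has_sum
      (\<Prod>i\<in>UNIV. if s $ i = s' $ i \<and> k $ i = k' $ i then 1 else 0)) UNIV"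
    using assms by (intro has_sum_tensor gtilde_htilde_biorthogonal mother_scaling_function_cardinal) auto
  note infsumI[OF this]
  then show ?thesis
    by (simp add: gtilde_tensor_def htilde_tensor_def prod.distrib prod_if_delta vec_eq_iff)
qed

lemma tensor_resolution:
  fixes m m' :: "int ^ 'n"
  shows "(\<Sum>s | \<forall>i. s $ i \<in> {0, 1}. \<Sum>\<^sub>\<infinity>k. htilde_tensor \<phi> s (m - 2 * k) * gtilde_tensor \<phi> s (m' - 2 * k)) =
    (if m = m' then 1 else 0)"
proof -
  let ?F = "\<lambda>i s k. htilde \<phi> s (m $ i - 2 * k) * gtilde \<phi> s (m' $ i - 2 * k)"
  have fin: "finite {k. ?F i s k \<noteq> 0}" for i s
  proof -
    have "finite ((\<lambda>k. m' $ i - 2 * k) -` {l. gtilde \<phi> s l \<noteq> 0})"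
      by (intro finite_vimageI finite_gtilde) (simp add: inj_def)
    then show ?thesis by (rule finite_subset[rotated]) auto
  qed
  have "(\<Sum>\<^sub>\<infinity>k. htilde_tensor \<phi> s (m - 2 * k) * gtilde_tensor \<phi> s (m' - 2 * k)) =
      (\<Prod>i\<in>UNIV. \<Sum>\<^sub>\<infinity>k. ?F i (s $ i) k)" for s
  proof -
    have "((\<lambda>k. \<Prod>i\<in>UNIV. ?F i (s $ i) (k $ i)) has_sum (\<Prod>i\<in>UNIV. \<Sum>\<^sub>\<infinity>k. ?F i (s $ i) k)) UNIV"
      by (intro has_sum_tensor fin has_sum_infsum finite_nonzero_values_imp_summable_on)
        (use fin in simp)
    note infsumI[OF this]
    then show ?thesis
      by (simp add: gtilde_tensor_def htilde_tensor_def prod.distrib)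
  qed
  then have "(\<Sum>s | \<forall>i. s $ i \<in> {0, 1}. \<Sum>\<^sub>\<infinity>k. htilde_tensor \<phi> s (m - 2 * k) * gtilde_tensor \<phi> s (m' - 2 * k)) =
      (\<Prod>i\<in>UNIV. \<Sum>s\<in>{0, 1}. \<Sum>\<^sub>\<infinity>k. ?F i s k)"
    using sum_vec_box[of "\<lambda>_. {0, 1}" "\<lambda>i s. \<Sum>\<^sub>\<infinity>k. ?F i s k"] by simp
  also have "\<dots> = (\<Prod>i\<in>UNIV. if m $ i = m' $ i then 1 else 0)"
    by (intro prod.cong refl gtilde_htilde_resolution_sum mother_scaling_function_cardinal)
  finally show ?thesis
    by (simp add: prod_if_delta vec_eq_iff)
qed

end

section \<open>Functionals given by absolutely convergent series\<close>

lemma scaleK_apply: "blinfun_apply (scaleK c T) f = c * blinfun_apply T f"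
  by (simp add: scaleK_def)

lemma norm_scaleK_le: "norm (scaleK c T) \<le> norm c * norm T"
proof (rule norm_blinfun_bound)
  fix f
  have "norm (blinfun_apply T f) \<le> norm T * norm f"
    by (rule norm_blinfun)
  then show "norm (blinfun_apply (scaleK c T) f) \<le> norm c * norm T * norm f"
    by (simp add: scaleK_apply norm_mult mult.assoc mult_left_mono)
qed simp

text \<open>
  The pointwise reading of \<open>T = \<Sum>k. d k U k\<close>. For \<open>d\<close> in \<open>\<ell>\<^sup>1\<close> and bounded \<open>U\<close> it is equivalent to
  convergence in norm, by completeness of the dual, and it reduces identities between functionals to
  identities between scalar series.
\<close>

definition represents ::
    "('i \<Rightarrow> 'e::real_normed_vector \<Rightarrow>\<^sub>L 'k::{real_normed_field,banach}) \<Rightarrow> ('i \<Rightarrow> 'k) \<Rightarrow> ('e \<Rightarrow>\<^sub>L 'k) \<Rightarrow> bool"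
  where "represents U d T \<longleftrightarrow>
    (\<forall>f. blinfun_apply T f = (\<Sum>\<^sub>\<infinity>k. d k * blinfun_apply (U k) f))"

context
  fixes U :: "'i \<Rightarrow> 'e::real_normed_vector \<Rightarrow>\<^sub>L 'k::{real_normed_field,banach}" and M :: real
  assumes bounded: "\<And>k. norm (U k) \<le> M"
begin

lemma ell1_series_summable:
  assumes "ell1 d"
  shows "(\<lambda>k. scaleK (d k) (U k)) summable_on UNIV"
proof (rule abs_summable_summable)
  show "(\<lambda>k. norm (scaleK (d k) (U k))) summable_on UNIV"
  proof (rule summable_on_comparison_test[OF summable_on_cmult_left[OF assms, of M]])
    show "norm (scaleK (d k) (U k)) \<le> norm (d k) * M" for k
      using norm_scaleK_le[of "d k" "U k"] mult_left_mono[OF bounded[of k], of "norm (d k)"] by simp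
  qed simp
qed

lemma ell1_series_has_sum_apply:
  assumes "((\<lambda>k. scaleK (d k) (U k)) has_sum T) UNIV"
  shows "((\<lambda>k. d k * blinfun_apply (U k) f) has_sum blinfun_apply T f) UNIV"
  using has_sum_bounded_linear[OF blinfun.bounded_linear_left assms, of f]
  by (simp add: scaleK_apply)

lemma ell1_series_apply_summable:
  assumes "ell1 d"
  shows "(\<lambda>k. d k * blinfun_apply (U k) f) summable_on UNIV"
  using ell1_series_has_sum_apply[OF has_sum_infsum[OF ell1_series_summable[OF assms]]]
  by (rule has_sum_imp_summable)

lemma has_sum_iff_represents:
  assumes "ell1 d"
  shows "((\<lambda>k. scaleK (d k) (U k)) has_sum T) UNIV \<longleftrightarrow> represents U d T"
proof
  assume "((\<lambda>k. scaleK (d k) (U k)) has_sum T) UNIV"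
  from infsumI[OF ell1_series_has_sum_apply[OF this]] show "represents U d T"
    by (simp add: represents_def)
next
  assume T: "represents U d T"
  let ?S = "\<Sum>\<^sub>\<infinity>k. scaleK (d k) (U k)"
  have S: "((\<lambda>k. scaleK (d k) (U k)) has_sum ?S) UNIV"
    by (rule has_sum_infsum[OF ell1_series_summable[OF assms]])
  have "?S = T"
    using infsumI[OF ell1_series_has_sum_apply[OF S]] T
    by (intro blinfun_eqI) (simp add: represents_def)
  with S show "((\<lambda>k. scaleK (d k) (U k)) has_sum T) UNIV" by simp
qed

lemma represents_exists:
  assumes "ell1 d"
  shows "\<exists>T. represents U d T"
  using has_sum_infsum[OF ell1_series_summable[OF assms]] has_sum_iff_represents[OF assms] by blast

lemma represents_add:
  assumes "ell1 d" "ell1 d'" "represents U d T" "represents U d' T'"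
  shows "ell1 (\<lambda>k. d k + d' k) \<and> represents U (\<lambda>k. d k + d' k) (T + T')"
proof
  show "ell1 (\<lambda>k. d k + d' k)"
    by (rule summable_on_comparison_test[OF summable_on_add[OF assms(1,2)]])
      (auto intro: norm_triangle_ineq)
  show "represents U (\<lambda>k. d k + d' k) (T + T')"
    using assms
    by (simp add: represents_def blinfun.add_left distrib_right infsum_add ell1_series_apply_summable)
qed

lemma represents_sum:
  assumes "finite S" "\<And>s. s \<in> S \<Longrightarrow> ell1 (d s)" "\<And>s. s \<in> S \<Longrightarrow> represents U (d s) (T s)"
  shows "ell1 (\<lambda>k. \<Sum>s\<in>S. d s k) \<and> represents U (\<lambda>k. \<Sum>s\<in>S. d s k) (\<Sum>s\<in>S. T s)"
  using assms
proof (induction S rule: finite_induct)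
  case empty
  then show ?case by (simp add: represents_def)
next
  case (insert s S)
  then show ?case
    using represents_add[of "d s" "\<lambda>k. \<Sum>s\<in>S. d s k" "T s" "\<Sum>s\<in>S. T s"] by auto
qed

lemma represents_scaleK:
  assumes "ell1 d" "represents U d T"
  shows "ell1 (\<lambda>k. c * d k) \<and> represents U (\<lambda>k. c * d k) (scaleK c T)"
proof
  show "ell1 (\<lambda>k. c * d k)"
    using summable_on_cmult_right[OF assms(1), of "norm c"] by (simp add: norm_mult)
  show "represents U (\<lambda>k. c * d k) (scaleK c T)"
    using assms(2) by (simp add: represents_def scaleK_apply mult.assoc infsum_cmult_right')
qed

lemma subspaceK_represented: "subspaceK {T. \<exists>d. ell1 d \<and> represents U d T}"
proof -
  have "\<exists>d. ell1 d \<and> represents U d 0"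
    by (intro exI[of _ "\<lambda>_. 0"]) (simp add: represents_def)
  moreover have "\<exists>d. ell1 d \<and> represents U d (T + T')"
    if "ell1 d" "represents U d T" "ell1 d'" "represents U d' T'" for d d' T T'
    using represents_add[OF that(1,3,2,4)] by (intro exI[of _ "\<lambda>k. d k + d' k"])
  moreover have "\<exists>d. ell1 d \<and> represents U d (scaleK c T)"
    if "ell1 d" "represents U d T" for c d T
    using represents_scaleK[OF that] by (intro exI[of _ "\<lambda>k. c * d k"])
  ultimately show ?thesis
    unfolding subspaceK_def by (intro conjI ballI allI) auto
qed

lemma represents_in_dual:
  assumes "\<And>k. U k \<in> dual_space ev" "represents U d T"
  shows "T \<in> dual_space ev"
  unfolding dual_space_def
proof (intro CollectI allI impI)
  fix c f g assume "\<forall>x. ev g x = c * ev f x"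
  then have "blinfun_apply (U k) g = c * blinfun_apply (U k) f" for k
    using assms(1)[of k] by (auto simp: dual_space_def)
  then have "blinfun_apply T g = (\<Sum>\<^sub>\<infinity>k. c * (d k * blinfun_apply (U k) f))"
    using assms(2) by (simp add: represents_def mult.left_commute)
  then show "blinfun_apply T g = c * blinfun_apply T f"
    using assms(2) by (simp add: represents_def infsum_cmult_right')
qed

lemma ell1_span_eq:
  assumes "\<And>k. U k \<in> dual_space ev"
  shows "{T \<in> dual_space ev. \<exists>d. ell1 d \<and> ((\<lambda>k. scaleK (d k) (U k)) has_sum T) UNIV} =
    {T. \<exists>d. ell1 d \<and> represents U d T}"
  using has_sum_iff_represents represents_in_dual[OF assms] by blast

end

section \<open>A criterion for topological direct sums\<close>

lemma subspaceK_diff: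
  assumes "subspaceK A" "a \<in> A" "a' \<in> A"
  shows "a - a' \<in> A"
proof -
  have "scaleK (- 1) a' = - a'"
    by (rule blinfun_eqI) (simp add: scaleK_apply blinfun.minus_left)
  then have "- a' \<in> A"
    using assms(1,3) unfolding subspaceK_def by metis
  then have "a + - a' \<in> A"
    using assms(1,2) unfolding subspaceK_def by blast
  then show ?thesis by simp
qed

text \<open>
  A single inequality gives everything at once. Taking \<open>b = - a\<close> shows that the intersection is trivial,
  so that the projection \<open>P\<close> is well defined, and applying the inequality to differences shows that \<open>P\<close>
  is Lipschitz. The other projection is \<open>x - P x\<close>.
\<close>

lemma topological_direct_sumI:
  assumes A: "subspaceK A" and B: "subspaceK B"
    and C: "C = {a + b | a b. a \<in> A \<and> b \<in> B}"
    and bound: "\<And>a b. a \<in> A \<Longrightarrow> b \<in> B \<Longrightarrow> norm a \<le> L * norm (a + b)"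
  shows "topological_direct_sum C A B"
proof -
  have zero: "0 \<in> A" "0 \<in> B" using A B by (auto simp: subspaceK_def)
  have "x = 0" if "x \<in> A" "x \<in> B" for x
    using bound[OF that(1) subspaceK_diff[OF B zero(2) that(2)]] by simp
  with zero have inter: "A \<inter> B = {0}" by blast
  have close: "norm (a - a') \<le> L * norm ((a + b) - (a' + b'))"
    if "a \<in> A" "a' \<in> A" "b \<in> B" "b' \<in> B" for a a' b b'
    using bound[OF subspaceK_diff[OF A that(1,2)] subspaceK_diff[OF B that(3,4)]]
    by (simp add: algebra_simps)
  \<comment> \<open>Any choice of a first component will do: by \<open>close\<close> two of them coincide.\<close>
  define P where "P x = (SOME a. a \<in> A \<and> x - a \<in> B)" for x
  have P: "P (a + b) = a" if "a \<in> A" "b \<in> B" for a b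
  proof -
    have "P (a + b) \<in> A \<and> (a + b) - P (a + b) \<in> B"
      unfolding P_def by (rule someI[of _ a]) (use that in simp)
    then have "norm (P (a + b) - a) \<le> 0"
      using close[of "P (a + b)" a "(a + b) - P (a + b)" b] that by simp
    then show ?thesis by simp
  qed
  have "continuous_on C P"
  proof (rule lipschitz_on_continuous_on[of "max 0 L"], rule lipschitz_onI)
    fix x y assume "x \<in> C" "y \<in> C"
    then obtain a b a' b' where
      "x = a + b" "y = a' + b'" "a \<in> A" "b \<in> B" "a' \<in> A" "b' \<in> B"
      unfolding C by blast
    then have "dist (P x) (P y) \<le> L * dist x y"
      using close[of a a' b b'] by (simp add: P dist_norm)
    also have "\<dots> \<le> max 0 L * dist x y"
      by (intro mult_right_mono) auto
    finally show "dist (P x) (P y) \<le> max 0 L * dist x y" .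
  qed simp
  then have "continuous_on C P" "continuous_on C (\<lambda>x. x - P x)"
    by (auto intro: continuous_intros)
  moreover have "\<forall>a\<in>A. \<forall>b\<in>B. P (a + b) = a" "\<forall>a\<in>A. \<forall>b\<in>B. (a + b) - P (a + b) = b"
    by (simp_all add: P)
  ultimately show ?thesis
    unfolding topological_direct_sum_def using A B C inter by blast
qed

section \<open>Spaces of functions sampled on dyadic lattices\<close>

text \<open>
  The three properties shared by \<open>C\<^sub>u\<close> and \<open>C\<^sub>0\<close> on which the argument rests. The last one says that finite
  data of size at most one on a dyadic lattice can be interpolated, by zero outside a finite set,
  without increasing the norm; it makes point evaluations on the lattice behave like the unit vectors
  of \<open>\<ell>\<^sup>1\<close>.
\<close>

locale sampled_space =
  fixes ev :: "'e::real_normed_vector \<Rightarrow> real ^ 'n \<Rightarrow> 'k::{real_normed_field,banach}"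
  assumes linear: "\<And>x. bounded_linear (\<lambda>f. ev f x)"
    and norm_ev_le: "\<And>f x. norm (ev f x) \<le> norm f"
    and interpolation: "\<And>j F u. finite F \<Longrightarrow> (\<And>m. norm (u m) \<le> 1) \<Longrightarrow>
      \<exists>f. norm f \<le> 1 \<and> (\<forall>m. ev f (dyadic j m) = (if m \<in> F then u m else 0))"
begin

lemma norm_phi_tilde_le: "norm (phi_tilde ev j k) \<le> 1"
  by (rule norm_blinfun_bound) (simp_all add: phi_tilde_apply[OF linear] norm_ev_le)

lemma phi_tilde_in_dual: "phi_tilde ev j k \<in> dual_space ev"
  by (simp add: dual_space_def phi_tilde_apply[OF linear])

lemma V_tilde_eq: "V_tilde ev j = {T. \<exists>c. ell1 c \<and> represents (phi_tilde ev j) c T}"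
  unfolding V_tilde_def by (rule ell1_span_eq[OF norm_phi_tilde_le phi_tilde_in_dual])

text \<open>
  Together with the trivial converse \<open>norm_le_ell1\<close>, the map from \<open>\<ell>\<^sup>1\<close> to the dual is an isometry. The
  functional is tested on functions whose value at the \<open>m\<close>-th lattice point cancels the phase of \<open>c m\<close>,
  for \<open>m\<close> in a finite set.
\<close>

lemma ell1_norm_le:
  assumes c: "ell1 c" and T: "represents (phi_tilde ev j) c T"
  shows "(\<Sum>\<^sub>\<infinity>m. norm (c m)) \<le> norm T"
proof (rule infsum_le_finite_sums[OF c])
  fix F :: "(int ^ 'n) set" assume F: "finite F"
  \<comment> \<open>Division by zero yields the harmless value \<open>0\<close> where \<open>c m = 0\<close>.\<close>
  define u where "u m = of_real (norm (c m)) / c m" for m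
  have u: "norm (u m) \<le> 1" for m
    by (simp add: u_def norm_divide)
  obtain f where f: "norm f \<le> 1" "\<And>m. ev f (dyadic j m) = (if m \<in> F then u m else 0)"
    using interpolation[of F u j, OF F u] by blast
  have "blinfun_apply T f = (\<Sum>\<^sub>\<infinity>m. c m * (if m \<in> F then u m else 0))"
    using T by (simp add: represents_def phi_tilde_apply[OF linear] f(2))
  also have "\<dots> = (\<Sum>\<^sub>\<infinity>m\<in>F. of_real (norm (c m)))"
    by (rule infsum_cong_neutral) (auto simp: u_def)
  also have "\<dots> = of_real (\<Sum>m\<in>F. norm (c m))"
    using F by simp
  finally have "(\<Sum>m\<in>F. norm (c m)) = norm (blinfun_apply T f)"
    by (simp only: norm_of_real) (simp add: sum_nonneg)
  also have "norm (blinfun_apply T f) \<le> norm T * norm f"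
    by (rule norm_blinfun)
  also have "\<dots> \<le> norm T"
    using f(1) by (simp add: mult_left_le)
  finally show "(\<Sum>m\<in>F. norm (c m)) \<le> norm T" .
qed

lemma norm_le_ell1:
  assumes c: "ell1 c" and T: "represents (phi_tilde ev j) c T"
  shows "norm T \<le> (\<Sum>\<^sub>\<infinity>m. norm (c m))"
proof (rule norm_blinfun_bound)
  fix f
  have le: "norm (c m * ev f (dyadic j m)) \<le> norm (c m) * norm f" for m
    by (simp add: norm_mult mult_left_mono norm_ev_le)
  have cf: "(\<lambda>m. norm (c m) * norm f) summable_on UNIV"
    by (rule summable_on_cmult_left[OF c])
  have sm: "(\<lambda>m. norm (c m * ev f (dyadic j m))) summable_on UNIV"
    by (rule summable_on_comparison_test[OF cf le]) simp
  have "norm (blinfun_apply T f) = norm (\<Sum>\<^sub>\<infinity>m. c m * ev f (dyadic j m))"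
    using T by (simp add: represents_def phi_tilde_apply[OF linear])
  also have "\<dots> \<le> (\<Sum>\<^sub>\<infinity>m. norm (c m * ev f (dyadic j m)))"
    by (rule norm_infsum_bound[OF sm])
  also have "\<dots> \<le> (\<Sum>\<^sub>\<infinity>m. norm (c m) * norm f)"
    by (rule infsum_mono[OF sm cf le])
  also have "\<dots> = (\<Sum>\<^sub>\<infinity>m. norm (c m)) * norm f"
    by (rule infsum_cmult_left) (rule c)
  finally show "norm (blinfun_apply T f) \<le> (\<Sum>\<^sub>\<infinity>m. norm (c m)) * norm f" .
qed (simp add: infsum_nonneg)

end

section \<open>The wavelet decomposition of the dual spaces\<close>

definition binary_cube :: "(int ^ 'n) set"
  where "binary_cube = {s. \<forall>i. s $ i \<in> {0, 1}}"

lemma finite_binary_cube: "finite (binary_cube :: (int ^ 'n) set)"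
  unfolding binary_cube_def by (rule finite_vec_box) simp

lemma binary_cube_eq: "binary_cube = insert 0 (wavelet_indices :: (int ^ 'n) set)"
  by (auto simp: binary_cube_def wavelet_indices_def)

lemma finite_wavelet_indices: "finite (wavelet_indices :: (int ^ 'n) set)"
  using finite_binary_cube by (simp add: binary_cube_eq)

lemma zero_notin_wavelet_indices: "0 \<notin> wavelet_indices"
  by (simp add: wavelet_indices_def)

locale wavelet_setting = sampled_space ev
  for ev :: "'e::real_normed_vector \<Rightarrow> real ^ 'n \<Rightarrow> 'k::{real_normed_field,banach}" +
  fixes \<phi> :: "real \<Rightarrow> 'k" and j :: int
  assumes msf: "mother_scaling_function \<phi>"
begin

abbreviation g :: "int ^ 'n \<Rightarrow> int ^ 'n \<Rightarrow> 'k" where "g \<equiv> gtilde_tensor \<phi>"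
abbreviation h :: "int ^ 'n \<Rightarrow> int ^ 'n \<Rightarrow> 'k" where "h \<equiv> htilde_tensor \<phi>"
abbreviation "W s \<equiv> W_tilde_component ev \<phi> s j"

lemmas g_support = finite_support_gtilde_tensor[OF msf]
lemmas h_support = finite_support_htilde_tensor[OF msf]

lemma psi_tilde_apply_infsum:
  "blinfun_apply (psi_tilde ev \<phi> s j k) f =
    (\<Sum>\<^sub>\<infinity>m. g s (m - 2 * k) * ev f (dyadic (j + 1) m))"
proof -
  have shift: "(\<chi> i. 2 * k $ i + l $ i) = l + 2 * k" for l
    by (simp add: vec_eq_iff)
  have "bij (\<lambda>l. l + 2 * k)"
    by (rule bij_betw_byWitness[where f' = "\<lambda>m. m - 2 * k"]) auto
  from infsum_reindex_bij_betw[OF this, of "\<lambda>m. g s (m - 2 * k) * ev f (dyadic (j + 1) m)"]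
  have "(\<Sum>\<^sub>\<infinity>m. g s (m - 2 * k) * ev f (dyadic (j + 1) m)) =
      (\<Sum>\<^sub>\<infinity>l. g s l * ev f (dyadic (j + 1) (l + 2 * k)))"
    by simp
  also have "\<dots> = (\<Sum>l | g s l \<noteq> 0. g s l * ev f (dyadic (j + 1) (l + 2 * k)))"
    by (intro infsumI has_sum_finite_neutralI) (use g_support[of s] in \<open>auto simp: finite_support_def\<close>)
  finally show ?thesis
    by (simp add: psi_tilde_apply[OF linear] shift)
qed

lemma norm_psi_tilde_le: "norm (psi_tilde ev \<phi> s j k) \<le> filter_norm (g s)"
proof (rule norm_blinfun_bound)
  fix f
  have "norm (blinfun_apply (psi_tilde ev \<phi> s j k) f) \<le> (\<Sum>l | g s l \<noteq> 0. norm (g s l) * norm f)"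
    unfolding psi_tilde_apply[OF linear]
    by (rule sum_norm_le) (simp add: norm_mult mult_left_mono norm_ev_le)
  then show "norm (blinfun_apply (psi_tilde ev \<phi> s j k) f) \<le> filter_norm (g s) * norm f"
    by (simp add: filter_norm_def sum_distrib_right)
qed (rule filter_norm_nonneg)

lemma W_eq_represented: "W s = {T. \<exists>d. ell1 d \<and> represents (psi_tilde ev \<phi> s j) d T}"
  unfolding W_tilde_component_def
  by (rule ell1_span_eq[OF norm_psi_tilde_le psi_tilde_in_dual[OF linear]])

lemma subspaceK_W: "subspaceK (W s)"
  unfolding W_eq_represented by (rule subspaceK_represented[OF norm_psi_tilde_le])

lemma V_tilde_eq_W_zero: "V_tilde ev j = W 0"
  by (simp add: V_tilde_def W_tilde_component_def psi_tilde_zero)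

text \<open>
  In terms of coefficients, the inclusion of a wavelet space into the dual space of the finer
  lattice is the synthesis map.
\<close>

lemma represents_psi_iff_synthesis:
  assumes "ell1 d"
  shows "represents (psi_tilde ev \<phi> s j) d T \<longleftrightarrow>
    represents (phi_tilde ev (j + 1)) (synthesis (g s) d) T"
proof -
  have "(\<Sum>\<^sub>\<infinity>m. synthesis (g s) d m * ev f (dyadic (j + 1) m)) =
      (\<Sum>\<^sub>\<infinity>k. d k * blinfun_apply (psi_tilde ev \<phi> s j k) f)" for f
    unfolding psi_tilde_apply_infsum
    by (rule infsum_synthesis[OF g_support assms]) (rule norm_ev_le)
  then show ?thesis
    by (simp add: represents_def phi_tilde_apply[OF linear])
qed

text \<open>
  The key estimate. The coefficients \<open>d t\<close> of \<open>T t\<close> are recovered from the coefficients \<open>c\<close> of the whole sum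
  by the analysis map, because of biorthogonality. The bound then follows since synthesis and analysis
  are bounded on \<open>\<ell>\<^sup>1\<close> and the \<open>\<ell>\<^sup>1\<close> norm of \<open>c\<close> is the norm of the sum.
\<close>

lemma component_norm_le:
  assumes "t \<in> binary_cube" and T: "\<And>s. s \<in> binary_cube \<Longrightarrow> T s \<in> W s"
  shows "norm (T t) \<le> filter_norm (g t) * filter_norm (h t) * norm (\<Sum>s\<in>binary_cube. T s)"
proof -
  have "\<forall>s. \<exists>d. s \<in> binary_cube \<longrightarrow> ell1 d \<and> represents (psi_tilde ev \<phi> s j) d (T s)"
    using T unfolding W_eq_represented by blast
  then obtain d where "\<forall>s. s \<in> binary_cube \<longrightarrow> ell1 (d s) \<and> represents (psi_tilde ev \<phi> s j) (d s) (T s)"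
    by (rule choice[THEN exE])
  then have d: "ell1 (d s)" "represents (phi_tilde ev (j + 1)) (synthesis (g s) (d s)) (T s)"
    if "s \<in> binary_cube" for s
    using that represents_psi_iff_synthesis by blast+
  have syn: "ell1 (synthesis (g s) (d s))" if "s \<in> binary_cube" for s
    by (rule synthesis_summable[OF g_support d(1)[OF that]])
  define c where "c m = (\<Sum>s\<in>binary_cube. synthesis (g s) (d s) m)" for m
  have "ell1 c \<and> represents (phi_tilde ev (j + 1)) c (\<Sum>s\<in>binary_cube. T s)"
    unfolding c_def by (intro represents_sum[OF norm_phi_tilde_le finite_binary_cube] syn d(2))
  then have c: "ell1 c" "represents (phi_tilde ev (j + 1)) c (\<Sum>s\<in>binary_cube. T s)"
    by blast+
  have "analysis (h t) c k = d t k" for k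
  proof -
    have "analysis (h t) c k = (\<Sum>s\<in>binary_cube. analysis (h t) (synthesis (g s) (d s)) k)"
      unfolding c_def by (intro analysis_sum[THEN conjunct2] h_support finite_binary_cube syn)
    also have "\<dots> = (\<Sum>s\<in>binary_cube. if s = t then d s k else 0)"
    proof (rule sum.cong[OF refl])
      fix s :: "int ^ 'n" assume "s \<in> binary_cube"
      then have "analysis (h t) (synthesis (g s) (d s)) k = (if s = t then 1 else 0) * d s k"
        using assms(1) tensor_biorthogonal[OF msf, of s t]
        by (intro analysis_synthesis g_support h_support d(1)) (simp_all add: binary_cube_def)
      then show "analysis (h t) (synthesis (g s) (d s)) k = (if s = t then d s k else 0)"
        by simp
    qed
    also have "\<dots> = d t k"
      by (subst sum.delta[OF finite_binary_cube]) (simp add: assms(1))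
    finally show ?thesis .
  qed
  then have dt: "d t = analysis (h t) c" by auto
  have "norm (T t) \<le> (\<Sum>\<^sub>\<infinity>m. norm (synthesis (g t) (d t) m))"
    by (rule norm_le_ell1[OF syn d(2)]) (rule assms(1))+
  also have "\<dots> \<le> filter_norm (g t) * (\<Sum>\<^sub>\<infinity>k. norm (d t k))"
    by (rule synthesis_norm[OF g_support d(1)[OF assms(1)]])
  also have "\<dots> \<le> filter_norm (g t) * (filter_norm (h t) * (\<Sum>\<^sub>\<infinity>m. norm (c m)))"
    unfolding dt by (intro mult_left_mono analysis_norm h_support c(1) filter_norm_nonneg)
  also have "\<dots> \<le> filter_norm (g t) * (filter_norm (h t) * norm (\<Sum>s\<in>binary_cube. T s))"
    by (intro mult_left_mono filter_norm_nonneg ell1_norm_le[OF c])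
  finally show ?thesis by (simp add: mult.assoc)
qed

text \<open>
  Existence of the decomposition: the analysis map provides the coefficients of all the components,
  and perfect reconstruction shows that they add up to the given functional.
\<close>

lemma V_tilde_finer_eq:
  "V_tilde ev (j + 1) = {\<Sum>s\<in>binary_cube. T s | T. \<forall>s\<in>binary_cube. T s \<in> W s}"
proof (intro equalityI subsetI)
  fix S assume "S \<in> V_tilde ev (j + 1)"
  then obtain c where c: "ell1 c" "represents (phi_tilde ev (j + 1)) c S"
    by (auto simp: V_tilde_eq)
  have d: "ell1 (analysis (h s) c)" for s
    by (rule analysis_summable[OF h_support c(1)])
  have "\<forall>s. \<exists>T. represents (psi_tilde ev \<phi> s j) (analysis (h s) c) T"
    by (intro allI represents_exists[OF norm_psi_tilde_le d])
  then obtain T where T: "\<And>s. represents (psi_tilde ev \<phi> s j) (analysis (h s) c) (T s)"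
    by metis
  have "represents (phi_tilde ev (j + 1)) (synthesis (g s) (analysis (h s) c)) (T s)" for s
    using T[of s] represents_psi_iff_synthesis[OF d] by blast
  then have "represents (phi_tilde ev (j + 1)) (\<lambda>m. \<Sum>s\<in>binary_cube. synthesis (g s) (analysis (h s) c) m)
      (\<Sum>s\<in>binary_cube. T s)"
    by (intro represents_sum[OF norm_phi_tilde_le finite_binary_cube, THEN conjunct2]
        synthesis_summable g_support d)
  moreover have "(\<Sum>s\<in>binary_cube. synthesis (g s) (analysis (h s) c) m) = c m" for m
    by (rule synthesis_analysis[OF finite_binary_cube g_support h_support c(1)])
      (unfold binary_cube_def, rule tensor_resolution[OF msf])
  ultimately have "S = (\<Sum>s\<in>binary_cube. T s)"
    using c(2) by (intro blinfun_eqI) (simp add: represents_def)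
  moreover have "T s \<in> W s" for s
    using T d by (auto simp: W_eq_represented)
  ultimately show "S \<in> {\<Sum>s\<in>binary_cube. T s | T. \<forall>s\<in>binary_cube. T s \<in> W s}" by blast
next
  fix S assume "S \<in> {\<Sum>s\<in>binary_cube. T s | T. \<forall>s\<in>binary_cube. T s \<in> W s}"
  then obtain T where S: "S = (\<Sum>s\<in>binary_cube. T s)" and T: "\<And>s. s \<in> binary_cube \<Longrightarrow> T s \<in> W s"
    by blast
  have sub: "subspaceK (V_tilde ev (j + 1))"
    unfolding V_tilde_eq by (rule subspaceK_represented[OF norm_phi_tilde_le])
  have "W s \<subseteq> V_tilde ev (j + 1)" for s
    unfolding V_tilde_eq W_eq_represented
    using represents_psi_iff_synthesis synthesis_summable[OF g_support] by blast
  then have T_V: "T s \<in> V_tilde ev (j + 1)" if "s \<in> binary_cube" for s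
    using T[OF that] by blast
  have "(\<Sum>s\<in>F. T s) \<in> V_tilde ev (j + 1)" if "F \<subseteq> binary_cube" for F
    using finite_subset[OF that finite_binary_cube] that
    by (induction F rule: finite_induct) (use sub T_V in \<open>auto simp: subspaceK_def\<close>)
  then show "S \<in> V_tilde ev (j + 1)" by (simp add: S)
qed

text \<open>
  Extended by zero at \<open>s = 0\<close>, a family with sum zero falls under the key estimate, whose right-hand side
  then vanishes.
\<close>

lemma W_tilde_components_independent: "independent_family wavelet_indices W"
  unfolding independent_family_def
proof (intro allI impI ballI)
  fix w and t :: "int ^ 'n"
  assume w: "(\<forall>s\<in>wavelet_indices. w s \<in> W s) \<and> (\<Sum>s\<in>wavelet_indices. w s) = 0"
    and t: "t \<in> wavelet_indices"
  define T where "T s = (if s = 0 then 0 else w s)" for s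
  have sum: "(\<Sum>s\<in>wavelet_indices. T s) = (\<Sum>s\<in>wavelet_indices. w s)"
    by (rule sum.cong) (auto simp: T_def zero_notin_wavelet_indices)
  have "T s \<in> W s" if "s \<in> binary_cube" for s
    using that w subspaceK_W[of 0] by (auto simp: T_def binary_cube_eq subspaceK_def)
  from component_norm_le[OF _ this, of t] have "norm (T t) \<le> 0"
    using t w sum
    by (simp add: binary_cube_eq finite_wavelet_indices zero_notin_wavelet_indices) (simp add: T_def)
  then show "w t = 0"
    using t zero_notin_wavelet_indices by (auto simp: T_def split: if_splits)
qed

lemma subspaceK_W_tilde: "subspaceK (W_tilde ev \<phi> j)"
proof -
  have zero: "0 \<in> W_tilde ev \<phi> j"
    unfolding W_tilde_def using subspaceK_W
    by (intro CollectI exI[of _ "\<lambda>_. 0"]) (simp add: subspaceK_def)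
  have add: "S + S' \<in> W_tilde ev \<phi> j" if S: "S \<in> W_tilde ev \<phi> j" and S': "S' \<in> W_tilde ev \<phi> j" for S S'
  proof -
    obtain w where "S = (\<Sum>s\<in>wavelet_indices. w s)" "\<forall>s\<in>wavelet_indices. w s \<in> W s"
      using S unfolding W_tilde_def by blast
    moreover obtain w' where "S' = (\<Sum>s\<in>wavelet_indices. w' s)" "\<forall>s\<in>wavelet_indices. w' s \<in> W s"
      using S' unfolding W_tilde_def by blast
    ultimately show ?thesis
      unfolding W_tilde_def using subspaceK_W
      by (intro CollectI exI[of _ "\<lambda>s. w s + w' s"]) (simp add: subspaceK_def sum.distrib)
  qed
  have scale: "scaleK c S \<in> W_tilde ev \<phi> j" if S: "S \<in> W_tilde ev \<phi> j" for c S
  proof -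
    obtain w where w: "S = (\<Sum>s\<in>wavelet_indices. w s)" "\<forall>s\<in>wavelet_indices. w s \<in> W s"
      using S unfolding W_tilde_def by blast
    have "scaleK c S = (\<Sum>s\<in>wavelet_indices. scaleK c (w s))"
      by (rule blinfun_eqI) (simp add: w(1) scaleK_apply blinfun.sum_left sum_distrib_left)
    with w(2) show ?thesis
      unfolding W_tilde_def using subspaceK_W
      by (intro CollectI exI[of _ "\<lambda>s. scaleK c (w s)"]) (simp add: subspaceK_def)
  qed
  show ?thesis
    unfolding subspaceK_def using zero add scale by blast
qed

lemma sum_binary_cube:
  "(\<Sum>s\<in>binary_cube. (if s = 0 then a else w s)) = a + (\<Sum>s\<in>wavelet_indices. w s)"
proof -
  have "(\<Sum>s\<in>wavelet_indices. (if s = 0 then a else w s)) = (\<Sum>s\<in>wavelet_indices. w s)"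
    by (rule sum.cong) (auto simp: zero_notin_wavelet_indices)
  then show ?thesis
    by (simp add: binary_cube_eq finite_wavelet_indices zero_notin_wavelet_indices)
qed

lemma V_tilde_topological_direct_sum:
  "topological_direct_sum (V_tilde ev (j + 1)) (V_tilde ev j) (W_tilde ev \<phi> j)"
proof (rule topological_direct_sumI)
  show "subspaceK (V_tilde ev j)"
    unfolding V_tilde_eq_W_zero by (rule subspaceK_W)
  show "subspaceK (W_tilde ev \<phi> j)"
    by (rule subspaceK_W_tilde)
  show "V_tilde ev (j + 1) = {a + b | a b. a \<in> V_tilde ev j \<and> b \<in> W_tilde ev \<phi> j}"
  proof (intro equalityI subsetI)
    fix S assume "S \<in> V_tilde ev (j + 1)"
    then obtain T where S: "S = (\<Sum>s\<in>binary_cube. T s)" and T: "\<forall>s\<in>binary_cube. T s \<in> W s"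
      unfolding V_tilde_finer_eq by blast
    have "S = T 0 + (\<Sum>s\<in>wavelet_indices. T s)"
      by (simp add: S binary_cube_eq finite_wavelet_indices zero_notin_wavelet_indices)
    moreover have "T 0 \<in> V_tilde ev j"
      using T by (simp add: V_tilde_eq_W_zero binary_cube_eq)
    moreover have "(\<Sum>s\<in>wavelet_indices. T s) \<in> W_tilde ev \<phi> j"
      unfolding W_tilde_def using T binary_cube_eq by blast
    ultimately show "S \<in> {a + b | a b. a \<in> V_tilde ev j \<and> b \<in> W_tilde ev \<phi> j}" by blast
  next
    fix S assume "S \<in> {a + b | a b. a \<in> V_tilde ev j \<and> b \<in> W_tilde ev \<phi> j}"
    then obtain a w where S: "S = a + (\<Sum>s\<in>wavelet_indices. w s)"
      and a: "a \<in> W 0" and w: "\<forall>s\<in>wavelet_indices. w s \<in> W s"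
      unfolding W_tilde_def V_tilde_eq_W_zero by blast
    have "\<forall>s\<in>binary_cube. (if s = 0 then a else w s) \<in> W s"
      using a w by (simp add: binary_cube_eq)
    then show "S \<in> V_tilde ev (j + 1)"
      unfolding V_tilde_finer_eq S by (intro CollectI exI[of _ "\<lambda>s. if s = 0 then a else w s"])
        (simp add: sum_binary_cube)
  qed
  show "norm a \<le> filter_norm (g 0) * filter_norm (h 0) * norm (a + b)"
    if "a \<in> V_tilde ev j" "b \<in> W_tilde ev \<phi> j" for a b
  proof -
    obtain w where w: "b = (\<Sum>s\<in>wavelet_indices. w s)" "\<forall>s\<in>wavelet_indices. w s \<in> W s"
      using \<open>b \<in> W_tilde ev \<phi> j\<close> unfolding W_tilde_def by blast
    have "(if s = 0 then a else w s) \<in> W s" if "s \<in> binary_cube" for s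
      using that w(2) \<open>a \<in> V_tilde ev j\<close> by (auto simp: binary_cube_eq V_tilde_eq_W_zero)
    from component_norm_le[OF _ this, of 0] show ?thesis
      by (simp add: sum_binary_cube w(1)) (simp add: binary_cube_eq)
  qed
qed

end

section \<open>Interpolation on dyadic lattices\<close>

lemma dyadic_separated:
  fixes m m' :: "int ^ 'n"
  assumes "m \<noteq> m'"
  shows "1 \<le> 2 powi j * dist (dyadic j m) (dyadic j m' :: real ^ 'n)"
proof -
  obtain i where i: "m $ i \<noteq> m' $ i"
    using assms by (auto simp: vec_eq_iff)
  have "1 \<le> \<bar>real_of_int (m $ i - m' $ i)\<bar>"
    using i by linarith
  also have "\<dots> = 2 powi j * dist (dyadic j m $ i) (dyadic j m' $ i)"
    by (simp add: dyadic_def dist_real_def abs_divide flip: diff_divide_distrib)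
  also have "\<dots> \<le> 2 powi j * dist (dyadic j m) (dyadic j m' :: real ^ 'n)"
    by (intro mult_left_mono dist_vec_nth_le) simp
  finally show ?thesis .
qed

text \<open>
  A finite sum of cone functions, one for each lattice point in \<open>F\<close>, of radius half the mesh width. Their
  supports overlap at most on the boundary, where they vanish, so the supremum norm of the sum is the
  largest of the values at the lattice points.
\<close>

lemma dyadic_interpolation:
  fixes u :: "int ^ 'n \<Rightarrow> 'k::real_normed_vector"
  assumes F: "finite F" and u: "\<And>m. norm (u m) \<le> 1"
  obtains f :: "real ^ 'n \<Rightarrow> 'k"
  where "uniformly_continuous_on UNIV f" "(f \<longlongrightarrow> 0) at_infinity" "\<And>x. norm (f x) \<le> 1"
    "\<And>m. f (dyadic j m) = (if m \<in> F then u m else 0)"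
proof -
  define r :: real where "r = 2 powi j"
  have r: "0 < r" by (simp add: r_def)
  define b where "b m x = max 0 (1 - 2 * r * dist x (dyadic j m))" for m and x :: "real ^ 'n"
  have b_range: "0 \<le> b m x" "b m x \<le> 1" for m x
    using r by (auto simp: b_def)
  have sep: "1 \<le> r * dist (dyadic j m) (dyadic j m' :: real ^ 'n)" if "m \<noteq> m'" for m m'
    using dyadic_separated[OF that, of j] by (simp add: r_def)
  have disjoint: "m = m'" if "b m x \<noteq> 0" "b m' x \<noteq> 0" for m m' x
  proof (rule ccontr)
    assume "m \<noteq> m'"
    have "2 * (r * dist x (dyadic j m)) < 1" "2 * (r * dist x (dyadic j m')) < 1"
      using that by (auto simp: b_def max_def split: if_splits)
    moreover have "r * dist (dyadic j m) (dyadic j m' :: real ^ 'n) \<le>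
        r * (dist x (dyadic j m) + dist x (dyadic j m'))"
      using r by (intro mult_left_mono) (auto simp: dist_triangle3)
    ultimately show False
      using sep[OF \<open>m \<noteq> m'\<close>] by (simp add: distrib_left)
  qed
  have b_node: "b m (dyadic j m') = (if m' = m then 1 else 0)" for m m'
  proof (cases "m' = m")
    case False
    then show ?thesis using sep[of m' m] by (simp add: b_def)
  qed (simp add: b_def)
  define f where "f x = (\<Sum>m\<in>F. b m x *\<^sub>R u m)" for x
  have "(2 * r)-lipschitz_on UNIV (b m)" for m
  proof (rule lipschitz_onI)
    fix x y :: "real ^ 'n"
    have "dist (b m x) (b m y) \<le> \<bar>2 * r * dist x (dyadic j m) - 2 * r * dist y (dyadic j m)\<bar>"
      by (auto simp: b_def dist_real_def max_def)
    also have "\<dots> = 2 * r * \<bar>dist x (dyadic j m) - dist y (dyadic j m)\<bar>"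
      using r by (simp add: abs_mult flip: right_diff_distrib)
    also have "\<dots> \<le> 2 * r * dist x y"
      using r abs_dist_diff_le[of x "dyadic j m" y] by (intro mult_left_mono) (auto simp: dist_commute)
    finally show "dist (b m x) (b m y) \<le> 2 * r * dist x y" .
  qed (use r in simp)
  then have "uniformly_continuous_on UNIV (b m)" for m
    by (rule lipschitz_on_uniformly_continuous)
  then have uc: "uniformly_continuous_on UNIV (\<lambda>x. b m x *\<^sub>R u m)" for m
    by (rule bounded_linear.uniformly_continuous_on[OF bounded_linear_scaleR_left])
  have uniform: "uniformly_continuous_on UNIV f"
    unfolding f_def using F
    by (induction F rule: finite_induct)
      (simp_all add: uniformly_continuous_on_add uc uniformly_continuous_on_const)
  have "(b m \<longlongrightarrow> 0) at_infinity" for m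
  proof (rule tendsto_eventually)
    show "\<forall>\<^sub>F x in at_infinity. b m x = 0"
      unfolding eventually_at_infinity
    proof (intro exI allI impI)
      fix x :: "real ^ 'n"
      assume "1 / r + norm (dyadic j m :: real ^ 'n) \<le> norm x"
      then have "1 / r \<le> dist x (dyadic j m)"
        using norm_triangle_ineq2[of x "dyadic j m"] by (simp add: dist_norm)
      then have "1 \<le> r * dist x (dyadic j m)"
        using r by (simp add: field_simps)
      then show "b m x = 0" by (simp add: b_def)
    qed
  qed
  then have "((\<lambda>x. b m x *\<^sub>R u m) \<longlongrightarrow> 0) at_infinity" for m
    using tendsto_scaleR[OF _ tendsto_const, of "b m" 0 at_infinity "u m"] by simp
  then have vanishing: "(f \<longlongrightarrow> 0) at_infinity"
    unfolding f_def by (intro tendsto_null_sum)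
  have bound: "norm (f x) \<le> 1" for x
  proof (cases "\<exists>m\<in>F. b m x \<noteq> 0")
    case True
    then obtain m where m: "m \<in> F" "b m x \<noteq> 0" by blast
    have "b m' x = 0" if "m' \<in> F - {m}" for m'
      using disjoint[of m' x m] m(2) that by blast
    then have "f x = (\<Sum>m'\<in>{m}. b m' x *\<^sub>R u m')"
      unfolding f_def using F m(1) by (intro sum.mono_neutral_right) simp_all
    then have "norm (f x) = b m x * norm (u m)"
      using b_range(1)[of m x] by simp
    then show ?thesis
      using mult_le_one[OF b_range(2)[of m x] norm_ge_zero u[of m]] by simp
  qed (simp add: f_def)
  have nodes: "f (dyadic j m) = (if m \<in> F then u m else 0)" for m
  proof -
    have "f (dyadic j m) = (\<Sum>m'\<in>F. if m = m' then u m' else 0)"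
      unfolding f_def by (rule sum.cong) (auto simp: b_node)
    then show ?thesis using F by simp
  qed
  show thesis by (rule that[OF uniform vanishing bound nodes])
qed

lemma bcontfun_of_bounded:
  fixes f :: "'a::euclidean_space \<Rightarrow> 'k::real_normed_vector"
  assumes "uniformly_continuous_on UNIV f" "\<And>x. norm (f x) \<le> 1"
  shows "apply_bcontfun (Bcontfun f) = f" "norm (Bcontfun f) \<le> 1"
proof -
  have "f \<in> bcontfun"
    using assms by (auto simp: bcontfun_def bounded_iff intro: uniformly_continuous_imp_continuous)
  then show f: "apply_bcontfun (Bcontfun f) = f"
    by (rule Bcontfun_inverse)
  show "norm (Bcontfun f) \<le> 1"
    by (rule norm_bound) (simp add: f assms(2))
qed

lemma sampled_space_cu:
  "sampled_space (cu_apply :: (real ^ 'n, 'k::{real_normed_field,banach}) cu \<Rightarrow> _)"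
proof (rule sampled_space.intro)
  show "bounded_linear (\<lambda>f. cu_apply f x)" for x :: "real ^ 'n"
    by (rule bounded_linear_cu_apply)
  show "norm (cu_apply f x) \<le> norm f" for f :: "(real ^ 'n, 'k) cu" and x
    by (simp add: cu_apply_def norm_cu.rep_eq norm_bounded)
  fix j :: int and F :: "(int ^ 'n) set" and u :: "int ^ 'n \<Rightarrow> 'k"
  assume "finite F" "\<And>m. norm (u m) \<le> 1"
  then obtain f :: "real ^ 'n \<Rightarrow> 'k" where f: "uniformly_continuous_on UNIV f" "\<And>x. norm (f x) \<le> 1"
    "\<And>m. f (dyadic j m) = (if m \<in> F then u m else 0)"
    by (rule dyadic_interpolation[of F u j]) blast
  note b = bcontfun_of_bounded[OF f(1,2)]
  have "bcontfun_of_cu (Abs_cu (Bcontfun f)) = Bcontfun f"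
    by (rule Abs_cu_inverse) (simp add: b f(1))
  then show "\<exists>f :: (real ^ 'n, 'k) cu. norm f \<le> 1 \<and>
      (\<forall>m. cu_apply f (dyadic j m) = (if m \<in> F then u m else 0))"
    by (intro exI[of _ "Abs_cu (Bcontfun f)"]) (simp add: norm_cu.rep_eq cu_apply_def b f(3))
qed

lemma sampled_space_c0:
  "sampled_space (c0_apply :: (real ^ 'n, 'k::{real_normed_field,banach}) c0 \<Rightarrow> _)"
proof (rule sampled_space.intro)
  show "bounded_linear (\<lambda>f. c0_apply f x)" for x :: "real ^ 'n"
    by (rule bounded_linear_c0_apply)
  show "norm (c0_apply f x) \<le> norm f" for f :: "(real ^ 'n, 'k) c0" and x
    by (simp add: c0_apply_def norm_c0.rep_eq norm_bounded)
  fix j :: int and F :: "(int ^ 'n) set" and u :: "int ^ 'n \<Rightarrow> 'k"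
  assume "finite F" "\<And>m. norm (u m) \<le> 1"
  then obtain f :: "real ^ 'n \<Rightarrow> 'k" where f: "uniformly_continuous_on UNIV f" "\<And>x. norm (f x) \<le> 1"
    "\<And>m. f (dyadic j m) = (if m \<in> F then u m else 0)" "(f \<longlongrightarrow> 0) at_infinity"
    by (rule dyadic_interpolation[of F u j]) blast
  note b = bcontfun_of_bounded[OF f(1,2)]
  have "bcontfun_of_c0 (Abs_c0 (Bcontfun f)) = Bcontfun f"
    by (rule Abs_c0_inverse) (simp add: b f(4))
  then show "\<exists>f :: (real ^ 'n, 'k) c0. norm f \<le> 1 \<and>
      (\<forall>m. c0_apply f (dyadic j m) = (if m \<in> F then u m else 0))"
    by (intro exI[of _ "Abs_c0 (Bcontfun f)"]) (simp add: norm_c0.rep_eq c0_apply_def b f(3))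
qed

theorem lemma8p13:
  fixes \<phi> :: "real \<Rightarrow> 'k::{real_normed_field,banach}" and j :: int
  assumes "mother_scaling_function \<phi>"
  shows
    "(independent_family wavelet_indices
        (\<lambda>s. W_tilde_component (cu_apply :: (real ^ 'n, 'k) cu \<Rightarrow> real ^ 'n \<Rightarrow> 'k) \<phi> s j) \<and>
      topological_direct_sum
        (V_tilde (cu_apply :: (real ^ 'n, 'k) cu \<Rightarrow> real ^ 'n \<Rightarrow> 'k) (j + 1))
        (V_tilde cu_apply j) (W_tilde cu_apply \<phi> j)) \<and>
     (independent_family wavelet_indices
        (\<lambda>s. W_tilde_component (c0_apply :: (real ^ 'n, 'k) c0 \<Rightarrow> real ^ 'n \<Rightarrow> 'k) \<phi> s j) \<and>
      topological_direct_sum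
        (V_tilde (c0_apply :: (real ^ 'n, 'k) c0 \<Rightarrow> real ^ 'n \<Rightarrow> 'k) (j + 1))
        (V_tilde c0_apply j) (W_tilde c0_apply \<phi> j))"
proof -
  interpret cu: wavelet_setting "cu_apply :: (real ^ 'n, 'k) cu \<Rightarrow> real ^ 'n \<Rightarrow> 'k" \<phi> j
    by (intro wavelet_setting.intro sampled_space_cu wavelet_setting_axioms.intro assms)
  interpret c0: wavelet_setting "c0_apply :: (real ^ 'n, 'k) c0 \<Rightarrow> real ^ 'n \<Rightarrow> 'k" \<phi> j
    by (intro wavelet_setting.intro sampled_space_c0 wavelet_setting_axioms.intro assms)
  show ?thesis
    by (intro conjI cu.W_tilde_components_independent cu.V_tilde_topological_direct_sum
        c0.W_tilde_components_independent c0.V_tilde_topological_direct_sum)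
qed

end
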